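(* Let $n\ge1$ and let $\mathfrak s=\operatorname{span}_{\mathbb R}\{x_k,y_k,z\}_{k=1}^n\subset\mathfrak{sp}_{2n+2}(\mathbb R)$, where $$x_k=\begin{pmatrix}E_{1,k+1}&0\\0&-E_{k+1,1}\end{pmatrix},\qquad y_k=\begin{pmatrix}0&E_{1,k+1}+E_{k+1,1}\\0&0\end{pmatrix},\qquad z=\begin{pmatrix}0&2E_{11}\\0&0\end{pmatrix},$$ so that $\mathfrak s\cong\mathfrak{hw}_n$ via $P_k\mapsto x_k$, $Q_k\mapsto y_k$, $Z\mapsto z$. Then every finite-dimensional complex irreducible representation of $\mathfrak{sp}_{2n+2}(\mathbb R)$ remains indecomposable upon restriction to $\mathfrak s$. Equivalently, with $\mathfrak s_T=\mathfrak s\otimes_{\mathbb R}\mathbb C=\bigoplus_{\alpha\in T}\mathbb CX_\alpha$, $T=\{\varepsilon_1-\varepsilon_k,\varepsilon_1+\varepsilon_k\}_{k=2}^{n+1}\cup\{2\varepsilon_1\}$, every finite-dimensional irreducible representation of $\mathfrak{sp}_{2n+2}(\mathbb C)$ remains indecomposable upon restriction to $\mathfrak s_T$. *)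

theory Defs
  imports Complex_Main "Jordan_Normal_Form.Matrix"
begin

text \<open>Elementary N x N matrix E_{ij}, indices 1-based as in the paper.\<close>
definition Emat :: "nat \<Rightarrow> nat \<Rightarrow> nat \<Rightarrow> real mat" where
  "Emat N i j = mat N N (\<lambda>(a, b). if a = i - 1 \<and> b = j - 1 then 1 else 0)"

definition Jmat :: "nat \<Rightarrow> real mat" where
  "Jmat N = four_block_mat (0\<^sub>m N N) (1\<^sub>m N) (- 1\<^sub>m N) (0\<^sub>m N N)"

definition sp_alg :: "nat \<Rightarrow> real mat set" where
  "sp_alg N = {X \<in> carrier_mat (2 * N) (2 * N).
      transpose_mat X * Jmat N + Jmat N * X = 0\<^sub>m (2 * N) (2 * N)}"

definition xgen :: "nat \<Rightarrow> nat \<Rightarrow> real mat" where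
  "xgen n k = four_block_mat (Emat (n+1) 1 (k+1)) (0\<^sub>m (n+1) (n+1))
                             (0\<^sub>m (n+1) (n+1)) (- Emat (n+1) (k+1) 1)"

definition ygen :: "nat \<Rightarrow> nat \<Rightarrow> real mat" where
  "ygen n k = four_block_mat (0\<^sub>m (n+1) (n+1)) (Emat (n+1) 1 (k+1) + Emat (n+1) (k+1) 1)
                             (0\<^sub>m (n+1) (n+1)) (0\<^sub>m (n+1) (n+1))"

definition zgen :: "nat \<Rightarrow> real mat" where
  "zgen n = four_block_mat (0\<^sub>m (n+1) (n+1)) ((2::real) \<cdot>\<^sub>m Emat (n+1) 1 1)
                           (0\<^sub>m (n+1) (n+1)) (0\<^sub>m (n+1) (n+1))"

inductive_set rspan :: "nat \<Rightarrow> real mat set \<Rightarrow> real mat set" for d G where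
  zero: "0\<^sub>m d d \<in> rspan d G"
| add: "g \<in> G \<Longrightarrow> X \<in> rspan d G \<Longrightarrow> c \<cdot>\<^sub>m g + X \<in> rspan d G"

definition s_alg :: "nat \<Rightarrow> real mat set" where
  "s_alg n = rspan (2 * (n+1))
     ({xgen n k | k. k \<in> {1..n}} \<union> {ygen n k | k. k \<in> {1..n}} \<union> {zgen n})"

definition lie_rep :: "real mat set \<Rightarrow> nat \<Rightarrow> (real mat \<Rightarrow> complex mat) \<Rightarrow> bool" where
  "lie_rep L m \<rho> \<longleftrightarrow>
     (\<forall>X\<in>L. \<rho> X \<in> carrier_mat m m) \<and>
     (\<forall>X\<in>L. \<forall>Y\<in>L. \<rho> (X + Y) = \<rho> X + \<rho> Y) \<and>
     (\<forall>X\<in>L. \<forall>c::real. \<rho> (c \<cdot>\<^sub>m X) = complex_of_real c \<cdot>\<^sub>m \<rho> X) \<and>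
     (\<forall>X\<in>L. \<forall>Y\<in>L. \<rho> (X * Y - Y * X) = \<rho> X * \<rho> Y - \<rho> Y * \<rho> X)"

definition csubspace_vec :: "nat \<Rightarrow> complex vec set \<Rightarrow> bool" where
  "csubspace_vec m W \<longleftrightarrow> W \<subseteq> carrier_vec m \<and> 0\<^sub>v m \<in> W \<and>
     (\<forall>u\<in>W. \<forall>v\<in>W. u + v \<in> W) \<and> (\<forall>c::complex. \<forall>u\<in>W. c \<cdot>\<^sub>v u \<in> W)"

definition invariant_sub :: "real mat set \<Rightarrow> (real mat \<Rightarrow> complex mat) \<Rightarrow> complex vec set \<Rightarrow> bool" where
  "invariant_sub L \<rho> W \<longleftrightarrow> (\<forall>X\<in>L. \<forall>w\<in>W. \<rho> X *\<^sub>v w \<in> W)"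

definition irreducible_rep :: "real mat set \<Rightarrow> nat \<Rightarrow> (real mat \<Rightarrow> complex mat) \<Rightarrow> bool" where
  "irreducible_rep L m \<rho> \<longleftrightarrow> m > 0 \<and>
     (\<forall>W. csubspace_vec m W \<and> invariant_sub L \<rho> W \<longrightarrow> W = {0\<^sub>v m} \<or> W = carrier_vec m)"

definition indecomposable_rep :: "real mat set \<Rightarrow> nat \<Rightarrow> (real mat \<Rightarrow> complex mat) \<Rightarrow> bool" where
  "indecomposable_rep L m \<rho> \<longleftrightarrow> m > 0 \<and>
     \<not> (\<exists>U W. csubspace_vec m U \<and> csubspace_vec m W \<and>
            invariant_sub L \<rho> U \<and> invariant_sub L \<rho> W \<and>
            U \<noteq> {0\<^sub>v m} \<and> W \<noteq> {0\<^sub>v m} \<and> U \<inter> W = {0\<^sub>v m} \<and>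
            (\<forall>v\<in>carrier_vec m. \<exists>u\<in>U. \<exists>w\<in>W. v = u + w))"

end

theory Submission
  imports Defs "Jordan_Normal_Form.Spectral_Radius" "Jordan_Normal_Form.DL_Rank"
begin

text \<open>
  A decomposition of \<open>V\<close> over \<open>\<ss>\<close> is the same as an idempotent \<open>E\<close> of \<open>End V\<close> commuting with \<open>\<ss>\<close>.
  The element \<open>H = diag(1, 0, \<dots>, 0, -1, 0, \<dots>, 0)\<close> grades \<open>\<ss>\<pp>\<close>, hence acts diagonalizably on the
  irreducible \<open>V\<close>, and it normalizes \<open>\<ss>\<close>; so each component of \<open>E\<close> of weight \<open>j\<close> under \<open>ad H\<close>
  again commutes with \<open>\<ss>\<close>. As \<open>z \<in> \<ss>\<close> belongs to an \<open>\<ss>\<ll>\<^sub>2\<close>-triple \<open>(z, H, f)\<close>, such a component is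
  a highest weight vector of \<open>End V\<close>: its weight \<open>j\<close> is a natural number, and for \<open>j = 0\<close> it also
  commutes with \<open>f\<close>. But \<open>\<ss>\<close> and \<open>f\<close> generate \<open>\<ss>\<pp>\<close>, so by Schur's lemma the weight 0 component
  is a scalar \<open>c\<close>, necessarily 0 or 1. Then \<open>E\<close> or \<open>1 - E\<close> is idempotent and strictly raises the
  grading, hence vanishes.
\<close>

subsection \<open>Matrices commuting with a graded family\<close>

definition commutator :: "'a::comm_ring_1 mat \<Rightarrow> 'a mat \<Rightarrow> 'a mat" where
  "commutator A B = A * B - B * A"

lemma commutator_carrier [simp]:
  "A \<in> carrier_mat m m \<Longrightarrow> B \<in> carrier_mat m m \<Longrightarrow> commutator A B \<in> carrier_mat m m"
  by (auto simp: commutator_def)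

lemma commutator_eq_0_iff:
  assumes "A \<in> carrier_mat m m" "B \<in> carrier_mat m m"
  shows "commutator A B = 0\<^sub>m m m \<longleftrightarrow> A * B = B * A"
proof
  assume *: "commutator A B = 0\<^sub>m m m"
  show "A * B = B * A"
  proof (rule eq_matI)
    fix i j assume ij: "i < dim_row (B * A)" "j < dim_col (B * A)"
    have "(A * B - B * A) $$ (i, j) = 0"
      using * ij assms by (simp add: commutator_def)
    then show "(A * B) $$ (i, j) = (B * A) $$ (i, j)"
      using ij by (simp del: index_mult_mat(1))
  qed (use assms in auto)
qed (use assms in \<open>auto simp: commutator_def\<close>)

lemma commutator_jacobi:
  assumes "A \<in> carrier_mat m m" "B \<in> carrier_mat m m" "C \<in> carrier_mat m m"
  shows "commutator A (commutator B C) = commutator (commutator A B) C + commutator B (commutator A C)"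
proof -
  note d = mult_minus_distrib_mat[of _ m m _ m] minus_mult_distrib_mat[of _ m m _ _ m]
    assoc_mult_mat[of _ m m _ m _ m] mult_carrier_mat[of _ m m _ m] minus_carrier_mat
  show ?thesis
    unfolding commutator_def using assms
    by (intro eq_matI) (auto simp: d simp del: index_mult_mat(1))
qed

lemma commutator_add_left:
  assumes "A \<in> carrier_mat m m" "B \<in> carrier_mat m m" "C \<in> carrier_mat m m"
  shows "commutator (A + B) C = commutator A C + commutator B C"
proof -
  note d = mult_add_distrib_mat[of _ m m _ m] add_mult_distrib_mat[of _ m m _ _ m]
  show ?thesis
    unfolding commutator_def using assms
    by (intro eq_matI) (auto simp: d simp del: index_mult_mat(1))
qed

lemma commutator_smult:
  assumes "A \<in> carrier_mat m m" "B \<in> carrier_mat m m"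
  shows "commutator (c \<cdot>\<^sub>m A) B = c \<cdot>\<^sub>m commutator A B"
    and "commutator A (c \<cdot>\<^sub>m B) = c \<cdot>\<^sub>m commutator A B"
proof -
  note d = mult_smult_distrib[of _ m m _ m] mult_smult_assoc_mat[of _ m m _ m]
  show "commutator (c \<cdot>\<^sub>m A) B = c \<cdot>\<^sub>m commutator A B"
    "commutator A (c \<cdot>\<^sub>m B) = c \<cdot>\<^sub>m commutator A B"
    unfolding commutator_def using assms
    by (intro eq_matI; auto simp: d right_diff_distrib simp del: index_mult_mat(1))+
qed

text \<open>By the Jacobi identity the centralizer of \<open>C\<close> is a Lie subalgebra. This
  carries commutation from generators over to the algebra they generate.\<close>

lemma commutator_commutator_eq_0:
  assumes "A \<in> carrier_mat m m" "B \<in> carrier_mat m m" "C \<in> carrier_mat m m"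
    and "commutator A C = 0\<^sub>m m m" "commutator B C = 0\<^sub>m m m"
  shows "commutator (commutator A B) C = 0\<^sub>m m m"
proof -
  have z: "commutator A (0\<^sub>m m m) = 0\<^sub>m m m" "commutator B (0\<^sub>m m m) = 0\<^sub>m m m"
    using assms by (auto simp: commutator_def)
  let ?X = "commutator (commutator A B) C"
  have "0\<^sub>m m m = ?X + 0\<^sub>m m m"
    using commutator_jacobi[OF assms(1-3)] assms(4,5) z by simp
  then show ?thesis
    using assms(1-3) by (simp add: right_add_zero_mat[of _ m m])
qed

lemma smult_eq_0_mat:
  fixes A :: "'a::field mat"
  assumes "A \<in> carrier_mat m m" "c \<cdot>\<^sub>m A = 0\<^sub>m m m" "c \<noteq> 0"
  shows "A = 0\<^sub>m m m"
proof (rule eq_matI)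
  fix i j assume "i < dim_row (0\<^sub>m m m :: 'a mat)" "j < dim_col (0\<^sub>m m m :: 'a mat)"
  then have "(c \<cdot>\<^sub>m A) $$ (i, j) = 0" and ij: "i < m" "j < m"
    using assms(2) by auto
  then show "A $$ (i, j) = 0\<^sub>m m m $$ (i, j)"
    using assms(1,3) by auto
qed (use assms in auto)

section \<open>Weights of matrices under a diagonal matrix\<close>

definition diag_of :: "nat \<Rightarrow> (nat \<Rightarrow> 'a::zero) \<Rightarrow> 'a mat" where
  "diag_of m d = mat m m (\<lambda>(i, j). if i = j then d i else 0)"

lemma diag_of_carrier [simp]: "diag_of m d \<in> carrier_mat m m"
  by (simp add: diag_of_def)

lemma diag_of_dim [simp]: "dim_row (diag_of m d) = m" "dim_col (diag_of m d) = m"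
  by (simp_all add: diag_of_def)

lemma commutator_diag_of_index:
  assumes "A \<in> carrier_mat m m" "a < m" "b < m"
  shows "commutator (diag_of m d) A $$ (a, b) = (d a - d b) * A $$ (a, b)"
proof -
  have "(diag_of m d * A) $$ (a, b) = (\<Sum>c<m. (if a = c then d a * A $$ (c, b) else 0))"
    using assms by (auto simp: if_distrib[of "\<lambda>x. x * _"] simp: diag_of_def scalar_prod_def atLeast0LessThan intro!: sum.cong cong: if_cong)
  moreover have "(A * diag_of m d) $$ (a, b) = (\<Sum>c<m. (if c = b then A $$ (a, c) * d b else 0))"
    using assms by (auto simp: if_distrib[of "\<lambda>x. _ * x"] diag_of_def scalar_prod_def atLeast0LessThan intro!: sum.cong cong: if_cong)
  ultimately show ?thesis
    using assms by (simp add: commutator_def algebra_simps del: index_mult_mat(1))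
qed

lemma weight_index:
  assumes "commutator (diag_of m d) A = k \<cdot>\<^sub>m A" "A \<in> carrier_mat m m"
    and "a < m" "b < m" "A $$ (a, b) \<noteq> (0 :: 'a :: idom)"
  shows "d a - d b = k"
  using commutator_diag_of_index[OF assms(2-4), of d] assms by simp

text \<open>The projection onto the eigenspace with eigenvalue \<open>j\<close> of bracketing with
  \<open>diag_of m d\<close>. The matrix units are eigenvectors of this operator, so projecting
  amounts to masking entries.\<close>

definition weight_part :: "nat \<Rightarrow> (nat \<Rightarrow> 'a) \<Rightarrow> 'a \<Rightarrow> 'a::comm_ring_1 mat \<Rightarrow> 'a mat" where
  "weight_part m d j A = mat m m (\<lambda>(a, b). if d a - d b = j then A $$ (a, b) else 0)"

lemma weight_part_carrier [simp]: "weight_part m d j A \<in> carrier_mat m m"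
  by (simp add: weight_part_def)

lemma commutator_weight_part:
  assumes "A \<in> carrier_mat m m"
  shows "commutator (diag_of m d) (weight_part m d j A) = j \<cdot>\<^sub>m weight_part m d j A"
proof (rule eq_matI)
  fix a b
  assume "a < dim_row (j \<cdot>\<^sub>m weight_part m d j A)" "b < dim_col (j \<cdot>\<^sub>m weight_part m d j A)"
  then have ab: "a < m" "b < m" by (auto simp: weight_part_def)
  show "commutator (diag_of m d) (weight_part m d j A) $$ (a, b) = (j \<cdot>\<^sub>m weight_part m d j A) $$ (a, b)"
    using ab by (subst commutator_diag_of_index) (auto simp: weight_part_def)
qed (auto simp: commutator_def weight_part_def diag_of_def)

text \<open>As \<open>X\<close> is homogeneous of weight \<open>k\<close>, the equation
  \<open>X * A = A * X\<close> splits by weight, and its component of weight \<open>j + k\<close>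
  involves only the weight \<open>j\<close> part of \<open>A\<close>.\<close>

lemma weight_part_commutes:
  fixes A :: "'a::idom mat"
  assumes X: "X \<in> carrier_mat m m" and A: "A \<in> carrier_mat m m"
    and wt: "commutator (diag_of m d) X = k \<cdot>\<^sub>m X" and comm: "commutator X A = 0\<^sub>m m m"
  shows "commutator X (weight_part m d j A) = 0\<^sub>m m m"
proof -
  let ?P = "weight_part m d j A"
  have XA: "X * A = A * X"
    using comm X A by (simp add: commutator_eq_0_iff)
  have "X * ?P = ?P * X"
  proof (rule eq_matI)
    fix a b assume "a < dim_row (?P * X)" "b < dim_col (?P * X)"
    then have ab: "a < m" "b < m" using X by (auto simp: weight_part_def)
    have "(X * ?P) $$ (a, b) = (\<Sum>c<m. X $$ (a, c) * (if d c - d b = j then A $$ (c, b) else 0))"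
      using ab X by (auto simp: weight_part_def scalar_prod_def atLeast0LessThan intro!: sum.cong)
    \<comment> \<open>A nonzero \<open>X $$ (a, c)\<close> has \<open>d a - d c = k\<close>, so the
      mask on \<open>(c, b)\<close> turns into a condition on \<open>(a, b)\<close> alone and can
      leave the sum over \<open>c\<close>.\<close>
    also have "\<dots> = (\<Sum>c<m. if d a - d b = j + k then X $$ (a, c) * A $$ (c, b) else 0)"
    proof (intro sum.cong refl)
      fix c assume "c \<in> {..<m}"
      then have "X $$ (a, c) \<noteq> 0 \<Longrightarrow> d a - d c = k"
        using weight_index[OF wt X] ab by simp
      then show "X $$ (a, c) * (if d c - d b = j then A $$ (c, b) else 0) =
          (if d a - d b = j + k then X $$ (a, c) * A $$ (c, b) else 0)"
        by (cases "X $$ (a, c) = 0") (auto simp: algebra_simps)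
    qed
    also have "\<dots> = (if d a - d b = j + k then (X * A) $$ (a, b) else 0)"
      using ab X A by (auto simp: scalar_prod_def atLeast0LessThan intro!: sum.cong)
    also have "\<dots> = (if d a - d b = j + k then (A * X) $$ (a, b) else 0)"
      by (simp only: XA)
    also have "\<dots> = (\<Sum>c<m. if d a - d b = j + k then A $$ (a, c) * X $$ (c, b) else 0)"
      using ab X A by (auto simp: scalar_prod_def atLeast0LessThan intro!: sum.cong)
    also have "\<dots> = (\<Sum>c<m. (if d a - d c = j then A $$ (a, c) else 0) * X $$ (c, b))"
    proof (intro sum.cong refl)
      fix c assume "c \<in> {..<m}"
      then have "X $$ (c, b) \<noteq> 0 \<Longrightarrow> d c - d b = k"
        using weight_index[OF wt X] ab by simp
      then show "(if d a - d b = j + k then A $$ (a, c) * X $$ (c, b) else 0) =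
          (if d a - d c = j then A $$ (a, c) else 0) * X $$ (c, b)"
        by (cases "X $$ (c, b) = 0") (auto simp: algebra_simps)
    qed
    also have "\<dots> = (?P * X) $$ (a, b)"
      using ab X by (auto simp: weight_part_def scalar_prod_def atLeast0LessThan intro!: sum.cong)
    finally show "(X * ?P) $$ (a, b) = (?P * X) $$ (a, b)" .
  qed (use X in \<open>auto simp: weight_part_def\<close>)
  then show ?thesis
    using X by (simp add: commutator_eq_0_iff)
qed

section \<open>Strings under sl2 acting by commutators\<close>

lemma sl2_highest_weight:
  fixes E F \<Phi> :: "'a::field_char_0 mat"
  assumes E: "E \<in> carrier_mat m m" and F: "F \<in> carrier_mat m m" and \<Phi>: "\<Phi> \<in> carrier_mat m m"
    and EF: "commutator E F = \<kappa> \<cdot>\<^sub>m diag_of m d" and "\<kappa> \<noteq> 0"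
    and HF: "commutator (diag_of m d) F = -2 \<cdot>\<^sub>m F"
    and H\<Phi>: "commutator (diag_of m d) \<Phi> = j \<cdot>\<^sub>m \<Phi>"
    and E\<Phi>: "commutator E \<Phi> = 0\<^sub>m m m" and "\<Phi> \<noteq> 0\<^sub>m m m"
  shows "\<exists>k::nat. j = of_nat k \<and> (k = 0 \<longrightarrow> commutator F \<Phi> = 0\<^sub>m m m)"
proof -
  let ?H = "diag_of m d"
  \<comment> \<open>The string through \<open>\<Phi>\<close> stops because \<open>ad H\<close> has finitely many eigenvalues, and the weight of the top
    vector can be read off where it stops.\<close>
  define \<psi> where "\<psi> i = (commutator F ^^ i) \<Phi>" for i
  have \<psi>_0: "\<psi> 0 = \<Phi>" and \<psi>_Suc: "\<psi> (Suc i) = commutator F (\<psi> i)" for i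
    by (simp_all add: \<psi>_def)
  have carr [simp]: "\<psi> i \<in> carrier_mat m m" for i
    by (induction i) (use F \<Phi> in \<open>simp_all add: \<psi>_0 \<psi>_Suc\<close>)
  have [simp]: "?H \<in> carrier_mat m m" "dim_row (\<psi> i) = m" "dim_col (\<psi> i) = m" for i
    using carr[of i] by (auto simp del: carr)
  have H\<psi>: "commutator ?H (\<psi> i) = (j - 2 * of_nat i) \<cdot>\<^sub>m \<psi> i" for i
  proof (induction i)
    case (Suc i)
    have "commutator ?H (\<psi> (Suc i)) = commutator (-2 \<cdot>\<^sub>m F) (\<psi> i) + commutator F ((j - 2 * of_nat i) \<cdot>\<^sub>m \<psi> i)"
      using commutator_jacobi[of ?H m F "\<psi> i"] F HF Suc by (simp add: \<psi>_Suc)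
    also have "\<dots> = -2 \<cdot>\<^sub>m \<psi> (Suc i) + (j - 2 * of_nat i) \<cdot>\<^sub>m \<psi> (Suc i)"
      using F by (simp add: commutator_smult[of _ m] \<psi>_Suc)
    also have "\<dots> = (j - 2 * of_nat (Suc i)) \<cdot>\<^sub>m \<psi> (Suc i)"
      by (intro eq_matI) (auto simp: algebra_simps)
    finally show ?case .
  qed (simp add: \<psi>_0 H\<Phi>)
  \<comment> \<open>Each application of \<open>F\<close> contributes one bracket with
    \<open>\<kappa> \<cdot>\<^sub>m ?H\<close>, so the coefficient is \<open>\<kappa>\<close> times
    the sum of the weights \<open>j - 2 * l\<close> for \<open>l \<le> i\<close>, which is
    \<open>(i + 1) * (j - i)\<close>.\<close>
  have E\<psi>: "commutator E (\<psi> (Suc i)) = (\<kappa> * of_nat (Suc i) * (j - of_nat i)) \<cdot>\<^sub>m \<psi> i" for i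
  proof (induction i)
    case 0
    have "commutator E (\<psi> (Suc 0)) = commutator (\<kappa> \<cdot>\<^sub>m ?H) \<Phi> + commutator F (0\<^sub>m m m)"
      using commutator_jacobi[of E m F \<Phi>] E F \<Phi> EF E\<Phi> by (simp add: \<psi>_Suc \<psi>_0)
    also have "commutator F (0\<^sub>m m m) = 0\<^sub>m m m"
      using F by (auto simp: commutator_def)
    also have "commutator (\<kappa> \<cdot>\<^sub>m ?H) \<Phi> = \<kappa> \<cdot>\<^sub>m (j \<cdot>\<^sub>m \<Phi>)"
      using \<Phi> H\<Phi> by (simp add: commutator_smult[of _ m])
    finally show ?case
      using \<Phi> by (intro eq_matI) (auto simp: \<psi>_0)
  next
    case (Suc i)
    have "commutator E (\<psi> (Suc (Suc i))) = commutator (\<kappa> \<cdot>\<^sub>m ?H) (\<psi> (Suc i)) +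
        commutator F ((\<kappa> * of_nat (Suc i) * (j - of_nat i)) \<cdot>\<^sub>m \<psi> i)"
      using commutator_jacobi[of E m F "\<psi> (Suc i)"] E F EF Suc by (simp add: \<psi>_Suc[of "Suc i"])
    also have "\<dots> = \<kappa> \<cdot>\<^sub>m ((j - 2 * of_nat (Suc i)) \<cdot>\<^sub>m \<psi> (Suc i)) +
        (\<kappa> * of_nat (Suc i) * (j - of_nat i)) \<cdot>\<^sub>m \<psi> (Suc i)"
      using F H\<psi>[of "Suc i"] by (simp add: commutator_smult[of _ m] \<psi>_Suc[of i, symmetric])
    also have "\<dots> = (\<kappa> * of_nat (Suc (Suc i)) * (j - of_nat (Suc i))) \<cdot>\<^sub>m \<psi> (Suc i)"
      by (intro eq_matI) (auto simp: algebra_simps)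
    finally show ?case .
  qed
  have "\<exists>i. \<psi> i = 0\<^sub>m m m"
  proof (rule ccontr)
    assume "\<nexists>i. \<psi> i = 0\<^sub>m m m"
    then have nz: "\<psi> i \<noteq> 0\<^sub>m m m" for i by blast
    have "j - 2 * of_nat i \<in> (\<lambda>(a, b). d a - d b) ` ({..<m} \<times> {..<m})" for i
    proof -
      obtain a b where ab: "a < m" "b < m" "\<psi> i $$ (a, b) \<noteq> 0"
        using nz[of i] eq_matI[of "\<psi> i" "0\<^sub>m m m"] by auto
      then have "d a - d b = j - 2 * of_nat i"
        using weight_index[OF H\<psi>] by simp
      with ab show ?thesis by force
    qed
    then have "range (\<lambda>i. j - 2 * of_nat i) \<subseteq> (\<lambda>(a, b). d a - d b) ` ({..<m} \<times> {..<m})"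
      by blast
    then have "finite (range (\<lambda>i::nat. j - 2 * of_nat i))"
      by (rule finite_subset) auto
    moreover have "inj (\<lambda>i::nat. j - 2 * of_nat i)"
      by (auto simp: inj_def)
    ultimately show False
      using finite_imageD infinite_UNIV_nat by blast
  qed
  \<comment> \<open>\<open>\<psi> 0 = \<Phi>\<close> is nonzero, so the first zero of the string has
    a predecessor \<open>k\<close>.\<close>
  then obtain k where k: "\<psi> (Suc k) = 0\<^sub>m m m" "\<psi> k \<noteq> 0\<^sub>m m m"
    using \<open>\<Phi> \<noteq> 0\<^sub>m m m\<close> exists_least_lemma[of "\<lambda>i. \<psi> i = 0\<^sub>m m m"] by (auto simp: \<psi>_0)
  have z: "commutator E (0\<^sub>m m m) = 0\<^sub>m m m"
    using E by (auto simp: commutator_def)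
  \<comment> \<open>Bracketing \<open>\<psi> (Suc k) = 0\<^sub>m m m\<close> with \<open>E\<close>
    leaves a multiple of the nonzero \<open>\<psi> k\<close>; in characteristic 0 the only factor
    able to vanish is \<open>j - of_nat k\<close>.\<close>
  have "(\<kappa> * of_nat (Suc k) * (j - of_nat k)) \<cdot>\<^sub>m \<psi> k = 0\<^sub>m m m"
    using E\<psi>[of k] unfolding k(1) by (simp only: z)
  with k(2) have "\<kappa> * of_nat (Suc k) * (j - of_nat k) = 0"
    using smult_eq_0_mat[OF carr] by blast
  then have "j = of_nat k"
    using \<open>\<kappa> \<noteq> 0\<close> of_nat_neq_0[of k, where ?'a = 'a] by simp
  moreover have "k = 0 \<longrightarrow> commutator F \<Phi> = 0\<^sub>m m m"
    using k(1) by (auto simp: \<psi>_0 \<psi>_Suc)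
  ultimately show ?thesis by blast
qed

subsection \<open>Representations of the symplectic algebra in generators and relations\<close>

text \<open>The value of the symplectic form on two basis vectors, that is, an entry of
  \<open>Jmat N\<close>. It is polymorphic because it serves as matrix entry over the reals and as
  structure constant over the complex numbers.\<close>

definition sympl :: "nat \<Rightarrow> nat \<Rightarrow> nat \<Rightarrow> 'a::comm_ring_1" where
  "sympl N a b = (if b = a + N then 1 else if a = b + N then -1 else 0)"

text \<open>For \<open>N = 0\<close> both tests would succeed at \<open>a = b\<close> and the value
  would be 1; positivity makes them exclusive.\<close>

lemma sympl_swap: "N > 0 \<Longrightarrow> sympl N b a = - sympl N a b"
  by (auto simp: sympl_def)

text \<open>\<open>t p q\<close> stands for the symmetric product of the basis vectors e_p and e_q.
  The bracket relation is the Poisson bracket of quadratic monomials, expanded by the Leibniz rule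
  from the form \<open>sympl\<close>.\<close>

locale sp_rep =
  fixes N m :: nat and t :: "nat \<Rightarrow> nat \<Rightarrow> complex mat"
  assumes N_pos: "N > 0"
    and t_carrier [simp]: "p < 2 * N \<Longrightarrow> q < 2 * N \<Longrightarrow> t p q \<in> carrier_mat m m"
    and t_sym: "t p q = t q p"
    and bracket: "p < 2 * N \<Longrightarrow> q < 2 * N \<Longrightarrow> r < 2 * N \<Longrightarrow> s < 2 * N \<Longrightarrow>
      commutator (t p q) (t r s) = sympl N q r \<cdot>\<^sub>m t p s + sympl N q s \<cdot>\<^sub>m t p r +
        sympl N p r \<cdot>\<^sub>m t q s + sympl N p s \<cdot>\<^sub>m t q r"
begin

text \<open>In terms of \<open>sp_gen\<close> below, \<open>t N 0\<close> is the image of \<open>H\<close>, \<open>t N N\<close> that of \<open>z\<close> and \<open>t 0 0\<close> a multiple of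
  that of \<open>f\<close>.\<close>

definition grade :: "nat \<Rightarrow> complex" where
  "grade r = (if r = N then 1 else if r = 0 then -1 else 0)"

lemma t_dim [simp]:
  assumes "p < 2 * N" "q < 2 * N"
  shows "dim_row (t p q) = m" "dim_col (t p q) = m"
  using t_carrier[OF assms] by auto

text \<open>In the Poisson picture \<open>t N 0\<close> scales e_r by \<open>grade r\<close>, and
  weights add up in products. Hence \<open>t N q\<close> with \<open>q\<close> nonzero has weight 1
  or 2, and \<open>t 0 0\<close> has weight -2.\<close>

lemma bracket_grading:
  assumes "r < 2 * N" "s < 2 * N"
  shows "commutator (t N 0) (t r s) = (grade r + grade s) \<cdot>\<^sub>m t r s"
proof -
  have "commutator (t N 0) (t r s) = sympl N 0 r \<cdot>\<^sub>m t N s + sympl N 0 s \<cdot>\<^sub>m t N r +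
      sympl N N r \<cdot>\<^sub>m t 0 s + sympl N N s \<cdot>\<^sub>m t 0 r"
    using bracket[of N 0 r s] assms N_pos by simp
  also have "\<dots> = sympl N 0 r \<cdot>\<^sub>m t N s + sympl N 0 s \<cdot>\<^sub>m t r N +
      sympl N N r \<cdot>\<^sub>m t 0 s + sympl N N s \<cdot>\<^sub>m t r 0"
    by (simp only: t_sym[of r])
  also have "\<dots> = (grade r + grade s) \<cdot>\<^sub>m t r s"
    using assms N_pos by (intro eq_matI) (auto simp: grade_def sympl_def)
  finally show ?thesis .
qed

text \<open>Up to scaling this completes an sl2-triple; the factor -4 becomes the constant
  \<open>\<kappa>\<close> of \<open>sl2_highest_weight\<close>.\<close>

lemma bracket_NN_00: "commutator (t N N) (t 0 0) = -4 \<cdot>\<^sub>m t N 0"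
  using bracket[of N N 0 0] N_pos by (simp, intro eq_matI) (auto simp: sympl_def)

text \<open>The \<open>t N q\<close> together with \<open>t 0 0\<close> generate everything:
  brackets of \<open>t 0 0\<close> with \<open>t N q\<close> yield the \<open>t 0 q\<close>, and
  brackets of \<open>t N p\<close> with \<open>t 0 q\<close> yield \<open>t p q\<close> modulo
  elements already treated.\<close>

lemma commutes_all_if_commutes_generators:
  assumes \<Phi>: "\<Phi> \<in> carrier_mat m m"
    and gen: "\<And>q. q < 2 * N \<Longrightarrow> commutator (t N q) \<Phi> = 0\<^sub>m m m"
    and low: "commutator (t 0 0) \<Phi> = 0\<^sub>m m m"
    and pq: "p < 2 * N" "q < 2 * N"
  shows "commutator (t p q) \<Phi> = 0\<^sub>m m m"
proof -
  have low': "commutator (t 0 q) \<Phi> = 0\<^sub>m m m" if q: "q < 2 * N" for q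
  proof (cases "q = N")
    case True
    then show ?thesis using gen[of 0] N_pos by (simp add: t_sym[of 0 N])
  next
    case False
    have "commutator (t 0 0) (t N q) = 2 \<cdot>\<^sub>m t 0 q + (2 * sympl N 0 q) \<cdot>\<^sub>m t 0 N"
      using bracket[of 0 0 N q] q N_pos by (simp, intro eq_matI) (auto simp: sympl_def)
    also have "\<dots> = 2 \<cdot>\<^sub>m t 0 q"
      using False q N_pos by (intro eq_matI) (auto simp: sympl_def)
    finally have "2 \<cdot>\<^sub>m commutator (t 0 q) \<Phi> = 0\<^sub>m m m"
      using commutator_commutator_eq_0[of "t 0 0" m "t N q" \<Phi>] gen[of q] low q N_pos \<Phi>
      by (simp add: commutator_smult[of _ m])
    then show ?thesis
      using q N_pos \<Phi> by (rule_tac smult_eq_0_mat[of _ m 2]) auto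
  qed
  \<comment> \<open>The coefficient -1 is \<open>sympl N N 0\<close>. The elements in the other
    three terms commute with \<open>\<Phi>\<close> by \<open>gen\<close> or by
    \<open>low'\<close>.\<close>
  have "commutator (t N p) (t 0 q) =
      sympl N p 0 \<cdot>\<^sub>m t N q + sympl N p q \<cdot>\<^sub>m t N 0 + -1 \<cdot>\<^sub>m t p q + sympl N N q \<cdot>\<^sub>m t p 0"
    using bracket[of N p 0 q] pq N_pos by (simp add: sympl_def[of N N 0])
  then have "commutator (sympl N p 0 \<cdot>\<^sub>m t N q + sympl N p q \<cdot>\<^sub>m t N 0 + -1 \<cdot>\<^sub>m t p q + sympl N N q \<cdot>\<^sub>m t p 0) \<Phi> = 0\<^sub>m m m"
    using commutator_commutator_eq_0[of "t N p" m "t 0 q" \<Phi>] gen[of p] low'[of q] pq N_pos \<Phi> by simp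
  then have "-1 \<cdot>\<^sub>m commutator (t p q) \<Phi> = 0\<^sub>m m m"
    using pq N_pos \<Phi> gen[of q] gen[of 0] low'[of p]
    by (simp add: commutator_add_left[of _ m] commutator_smult[of _ m] t_sym[of p 0])
  then show ?thesis
    using pq \<Phi> by (rule_tac smult_eq_0_mat[of _ m "-1"]) auto
qed

end

section \<open>Idempotents in a basis diagonalizing the grading\<close>

lemma nilpotent_idempotent_eq_0:
  fixes P :: "complex mat" and d :: "nat \<Rightarrow> complex"
  assumes P: "P \<in> carrier_mat m m" and idem: "P * P = P"
    and pos: "\<And>a b. a < m \<Longrightarrow> b < m \<Longrightarrow> P $$ (a, b) \<noteq> 0 \<Longrightarrow> \<exists>k::nat. k > 0 \<and> d a - d b = of_nat k"
  shows "P = 0\<^sub>m m m"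
proof -
  \<comment> \<open>\<open>P\<close> strictly raises the grading. An entry of degree
    \<open>k\<close> of \<open>P * P\<close> is a sum of products; in a nonzero product the degrees
    are positive and add up to \<open>k\<close>, so the second factor has smaller degree and
    vanishes by induction.\<close>
  have "\<forall>a<m. \<forall>b<m. d a - d b = of_nat k \<longrightarrow> P $$ (a, b) = 0" for k :: nat
  proof (induction k rule: less_induct)
    case (less k)
    show ?case
    proof (intro allI impI)
      fix a b assume ab: "a < m" "b < m" and k: "d a - d b = of_nat k"
      have "P $$ (a, b) = (P * P) $$ (a, b)" by (simp add: idem)
      also have "\<dots> = (\<Sum>c<m. P $$ (a, c) * P $$ (c, b))"
        using ab P by (auto simp: scalar_prod_def atLeast0LessThan intro!: sum.cong)
      also have "\<dots> = 0"
      proof (intro sum.neutral ballI)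
        fix c assume "c \<in> {..<m}"
        then have c: "c < m" by simp
        show "P $$ (a, c) * P $$ (c, b) = 0"
        proof (rule ccontr)
          assume "P $$ (a, c) * P $$ (c, b) \<noteq> 0"
          then have nz: "P $$ (a, c) \<noteq> 0" "P $$ (c, b) \<noteq> 0" by auto
          obtain i j :: nat where i: "i > 0" "d a - d c = of_nat i" and j: "d c - d b = of_nat j"
            using pos[OF ab(1) c nz(1)] pos[OF c ab(2) nz(2)] by blast
          have "(of_nat k :: complex) = of_nat (i + j)"
            unfolding of_nat_add k[symmetric] i(2)[symmetric] j[symmetric] by simp
          then have "j < k" using i(1) unfolding of_nat_eq_iff by simp
          then show False using less.IH[of j] c ab(2) j nz(2) by blast
        qed
      qed
      finally show "P $$ (a, b) = 0" .
    qed
  qed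
  then show ?thesis
    using P pos by (intro eq_matI) (auto, blast)
qed

text \<open>Schur's lemma is an assumption here so that the diagonal argument applies to a
  conjugated family, where it is obtained by conjugating back.\<close>

locale sp_rep_schur = sp_rep +
  assumes schur: "\<Phi> \<in> carrier_mat m m \<Longrightarrow>
      (\<And>p q. p < 2 * N \<Longrightarrow> q < 2 * N \<Longrightarrow> commutator (t p q) \<Phi> = 0\<^sub>m m m) \<Longrightarrow> \<exists>c. \<Phi> = c \<cdot>\<^sub>m 1\<^sub>m m"
begin

lemma commuting_idempotent_diagonal:
  assumes H: "t N 0 = diag_of m d"
    and P: "P \<in> carrier_mat m m" and idem: "P * P = P"
    and comm: "\<And>q. 0 < q \<Longrightarrow> q < 2 * N \<Longrightarrow> commutator (t N q) P = 0\<^sub>m m m"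
  shows "P = 0\<^sub>m m m \<or> P = 1\<^sub>m m"
proof -
  have part_comm: "commutator (t N q) (weight_part m d j P) = 0\<^sub>m m m" if "0 < q" "q < 2 * N" for q j
    using weight_part_commutes[OF _ P _ comm[OF that], of d _ j] bracket_grading[of N q] that N_pos
    by (simp add: H)
  have part_nat: "\<exists>k::nat. j = of_nat k \<and> (k = 0 \<longrightarrow> commutator (t 0 0) (weight_part m d j P) = 0\<^sub>m m m)"
    if "weight_part m d j P \<noteq> 0\<^sub>m m m" for j
  proof (rule sl2_highest_weight[of "t N N" m "t 0 0" _ "-4" d])
    show "commutator (t N N) (t 0 0) = -4 \<cdot>\<^sub>m diag_of m d"
      using bracket_NN_00 by (simp add: H)
    show "commutator (diag_of m d) (t 0 0) = -2 \<cdot>\<^sub>m t 0 0"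
      using bracket_grading[of 0 0] N_pos by (simp add: H grade_def)
  qed (use that P N_pos part_comm commutator_weight_part in auto)
  define P0 where "P0 = weight_part m d 0 P"
  have P0: "P0 \<in> carrier_mat m m" by (simp add: P0_def)
  have low: "commutator (t 0 0) P0 = 0\<^sub>m m m"
  proof (cases "P0 = 0\<^sub>m m m")
    case True
    then show ?thesis using N_pos by (auto simp: commutator_def)
  next
    case False
    then show ?thesis using part_nat[of 0] by (auto simp: P0_def)
  qed
  \<comment> \<open>The grading element is not covered by \<open>comm\<close>, but it commutes with
    any part of weight 0.\<close>
  have "commutator (t N 0) P0 = 0\<^sub>m m m"
    using commutator_weight_part[OF P, of d 0] by (simp add: H P0_def) (auto simp: weight_part_def)
  then have "commutator (t N q) P0 = 0\<^sub>m m m" if "q < 2 * N" for q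
    using part_comm[of q 0] that by (cases "q = 0") (auto simp: P0_def)
  then obtain c where c: "P0 = c \<cdot>\<^sub>m 1\<^sub>m m"
    using schur[OF P0] commutes_all_if_commutes_generators[OF P0 _ low] by blast
  \<comment> \<open>A nonzero entry at \<open>(a, b)\<close> witnesses that the part of weight
    \<open>d a - d b\<close> is nonzero, so \<open>part_nat\<close> makes that weight a natural
    number.\<close>
  have entry: "\<exists>k::nat. d a - d b = of_nat k" if "a < m" "b < m" "P $$ (a, b) \<noteq> 0" for a b
  proof -
    have "weight_part m d (d a - d b) P $$ (a, b) \<noteq> 0"
      using that by (simp add: weight_part_def)
    then have "weight_part m d (d a - d b) P \<noteq> 0\<^sub>m m m"
      using that by auto
    then show ?thesis using part_nat by blast
  qed
  have diag: "P $$ (a, b) = (if a = b then c else 0)" if "a < m" "b < m" "d a = d b" for a b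
  proof -
    have "P0 $$ (a, b) = P $$ (a, b)" using that by (simp add: P0_def weight_part_def)
    then show ?thesis using that by (cases "a = b") (simp_all add: c)
  qed
  show ?thesis
  proof (cases "c = 0")
    case True
    have "P = 0\<^sub>m m m"
    proof (rule nilpotent_idempotent_eq_0[OF P idem, of d])
      fix a b assume ab: "a < m" "b < m" "P $$ (a, b) \<noteq> 0"
      then obtain k :: nat where k: "d a - d b = of_nat k" using entry by blast
      have "d a \<noteq> d b" using diag[of a b] ab True by (auto split: if_splits)
      then have "k > 0" using k by (cases "k = 0") auto
      with k show "\<exists>k::nat. k > 0 \<and> d a - d b = of_nat k" by blast
    qed
    then show ?thesis ..
  next
    case False
    \<comment> \<open>The entry \<open>(0, 0)\<close> of \<open>P * P = P\<close> reads
      \<open>c * c = c\<close>: a nonzero term with \<open>d b \<noteq> d 0\<close> would need both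
      \<open>d 0 - d b\<close> and its negative to be natural numbers.\<close>
    have c1: "c = 1" if "m > 0"
    proof -
      have "P $$ (0, 0) = (P * P) $$ (0, 0)" by (simp add: idem)
      also have "\<dots> = (\<Sum>b<m. P $$ (0, b) * P $$ (b, 0))"
        using that P by (auto simp: scalar_prod_def atLeast0LessThan intro!: sum.cong)
      also have "\<dots> = (\<Sum>b<m. if b = 0 then c * c else 0)"
      proof (intro sum.cong refl)
        fix b assume "b \<in> {..<m}"
        then have b: "b < m" by simp
        show "P $$ (0, b) * P $$ (b, 0) = (if b = 0 then c * c else 0)"
        proof (cases "d b = d 0")
          case True
          then show ?thesis using diag[of 0 b] diag[of b 0] b that by auto
        next
          case False
          have "P $$ (0, b) * P $$ (b, 0) = 0"
          proof (rule ccontr)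
            assume "P $$ (0, b) * P $$ (b, 0) \<noteq> 0"
            then obtain i j :: nat where ij: "d 0 - d b = of_nat i" "d b - d 0 = of_nat j"
              using entry[of 0 b] entry[of b 0] b that by auto
            then have "(of_nat (i + j) :: complex) = of_nat 0"
              by (simp add: ij[symmetric])
            then show False using ij False unfolding of_nat_eq_iff by simp
          qed
          then show ?thesis using False by auto
        qed
      qed
      also have "\<dots> = c * c" using that by simp
      finally show ?thesis using diag[of 0 0] that False by simp
    qed
    \<comment> \<open>With \<open>c = 1\<close> the complement vanishes where
      \<open>d a = d b\<close>, and elsewhere its entries are minus those of \<open>P\<close>; so it
      strictly raises the grading.\<close>
    have "1\<^sub>m m - P = 0\<^sub>m m m"
    proof (rule nilpotent_idempotent_eq_0[of _ _ d])
      have "(1\<^sub>m m - P) * (1\<^sub>m m - P) = (1\<^sub>m m - P) - (P - P * P)"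
        using P by (simp add: minus_carrier_mat minus_mult_distrib_mat[of _ m m _ _ m] mult_minus_distrib_mat[of _ m m _ m])
      then show "(1\<^sub>m m - P) * (1\<^sub>m m - P) = 1\<^sub>m m - P"
        using P by (auto simp: idem)
      fix a b assume ab: "a < m" "b < m" "(1\<^sub>m m - P) $$ (a, b) \<noteq> 0"
      then have nz: "P $$ (a, b) \<noteq> (if a = b then 1 else 0)" using P by auto
      then have ne: "d a \<noteq> d b" using diag[of a b] c1 ab by auto
      then have "P $$ (a, b) \<noteq> 0" using nz by (cases "a = b") auto
      then obtain k :: nat where k: "d a - d b = of_nat k" using entry ab by blast
      then have "k > 0" using ne by (cases "k = 0") auto
      with k show "\<exists>k::nat. k > 0 \<and> d a - d b = of_nat k" by blast
    qed (use P in auto)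
    have "P = 1\<^sub>m m"
    proof (rule eq_matI)
      fix a b assume "a < dim_row (1\<^sub>m m :: complex mat)" "b < dim_col (1\<^sub>m m :: complex mat)"
      then have ab: "a < m" "b < m" by auto
      have "(1\<^sub>m m - P) $$ (a, b) = 0"
        using \<open>1\<^sub>m m - P = 0\<^sub>m m m\<close> ab by simp
      then show "P $$ (a, b) = 1\<^sub>m m $$ (a, b)" using ab P by simp
    qed (use P in auto)
    then show ?thesis ..
  qed
qed

end

section \<open>Diagonalization and Schur's lemma\<close>

lemma diagonalizable_if_eigenvectors_span:
  fixes A :: "complex mat"
  assumes A: "A \<in> carrier_mat m m"
    and span: "\<And>W. csubspace_vec m W \<Longrightarrow> {v \<in> carrier_vec m. \<exists>\<mu>. A *\<^sub>v v = \<mu> \<cdot>\<^sub>v v} \<subseteq> W \<Longrightarrow> W = carrier_vec m"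
  obtains P Q d where "P \<in> carrier_mat m m" "Q \<in> carrier_mat m m" "P * Q = 1\<^sub>m m" "Q * P = 1\<^sub>m m"
    "Q * A * P = diag_of m d"
proof -
  interpret vec_space "TYPE(complex)" m .
  define S where "S = {v \<in> carrier_vec m. \<exists>\<mu>. A *\<^sub>v v = \<mu> \<cdot>\<^sub>v v}"
  have S: "S \<subseteq> carrier_vec m" by (auto simp: S_def)
  \<comment> \<open>Independent subsets of \<open>S\<close> are bounded by the dimension, so a
    maximal one exists; by maximality it spans \<open>S\<close>.\<close>
  have "\<exists>B. finite B \<and> maximal B (\<lambda>T. T \<subseteq> S \<and> lin_indpt T)"
  proof (rule maximal_exists)
    show "finite T \<and> card T \<le> dim" if "T \<subseteq> S \<and> lin_indpt T" for T
      using li_le_dim[OF fin_dim, of T] that S by auto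
    show "{} \<subseteq> S \<and> lin_indpt {}" by (simp add: finite_lin_indpt2)
  qed
  then obtain B where fB: "finite B" and maxB: "maximal B (\<lambda>T. T \<subseteq> S \<and> lin_indpt T)" by blast
  then have BS: "B \<subseteq> S" and liB: "lin_indpt B" by (auto simp: maximal_def)
  have Bc: "B \<subseteq> carrier_vec m" using BS S by blast
  have "S \<subseteq> span B"
  proof
    fix v assume v: "v \<in> S"
    show "v \<in> span B"
    proof (cases "v \<in> B")
      case True
      then show ?thesis using in_own_span[OF Bc] by blast
    next
      case False
      then have "\<not> (B \<union> {v} \<subseteq> S \<and> lin_indpt (B \<union> {v}))"
        using maxB unfolding maximal_def by blast
      then have "lin_dep (B \<union> {v})" using v BS by blast
      then show ?thesis using lin_dep_iff_in_span[OF Bc liB _ False] v S by blast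
    qed
  qed
  moreover have sub: "submodule class_ring (span B) V"
    by (rule span_is_submodule[OF Bc])
  have "csubspace_vec m (span B)"
    unfolding csubspace_vec_def
    using submodule.subset[OF sub] submodule.zero_closed[OF sub] submodule.m_closed[OF sub]
      submodule.smult_closed[OF sub]
    by (auto simp: module_vec_simps class_ring_simps)
  ultimately have "span B = carrier_vec m" using span unfolding S_def by blast
  then have "basis B" using liB Bc by (simp add: basis_def)
  then have cardB: "card B = m" using dim_basis[OF fB] dim_is_n by simp
  obtain bs where bs: "set bs = B" "distinct bs" using finite_distinct_list[OF fB] by blast
  then have len: "length bs = m" using cardB distinct_card by fastforce
  define P where "P = mat_of_cols m bs"
  have P: "P \<in> carrier_mat m m" using len by (auto simp: P_def)
  have cols: "cols P = bs" using bs Bc by (simp add: P_def)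
  have "det P \<noteq> 0"
  proof
    assume "det P = 0"
    then obtain v where "v \<in> carrier_vec m" "v \<noteq> 0\<^sub>v m" "P *\<^sub>v v = 0\<^sub>v m"
      using det_0_iff_vec_prod_zero[OF P] by blast
    then have "lin_dep (set (cols P))" using lin_depI[OF P] cols bs by simp
    then show False using liB cols bs by simp
  qed
  then have "P \<in> Units (ring_mat TYPE(complex) m ())" by (rule det_non_zero_imp_unit[OF P])
  then obtain Q where Q: "Q \<in> carrier_mat m m" and PQ: "P * Q = 1\<^sub>m m" "Q * P = 1\<^sub>m m"
    by (auto simp: Units_def ring_mat_simps)
  have "\<exists>\<mu>. A *\<^sub>v col P i = \<mu> \<cdot>\<^sub>v col P i" if "i < m" for i
  proof -
    have "col P i = bs ! i" using cols that P by (metis cols_nth carrier_matD(2))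
    then have "col P i \<in> S" using that len bs BS by auto
    then show ?thesis by (simp add: S_def)
  qed
  then obtain d where d: "\<And>i. i < m \<Longrightarrow> A *\<^sub>v col P i = d i \<cdot>\<^sub>v col P i" by metis
  have "A * P = P * diag_of m d"
  proof (rule eq_matI)
    fix i j assume "i < dim_row (P * diag_of m d)" "j < dim_col (P * diag_of m d)"
    then have ij: "i < m" "j < m" using P by auto
    have "(A * P) $$ (i, j) = (A *\<^sub>v col P j) $ i" using ij A P by simp
    also have "\<dots> = d j * P $$ (i, j)" using ij P d[OF ij(2)] by simp
    also have "\<dots> = (\<Sum>c<m. if c = j then P $$ (i, c) * d j else 0)" using ij by simp
    also have "\<dots> = (P * diag_of m d) $$ (i, j)"
      using ij P by (auto simp: if_distrib[of "\<lambda>x. _ * x"] diag_of_def scalar_prod_def atLeast0LessThan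
          intro!: sum.cong cong: if_cong)
    finally show "(A * P) $$ (i, j) = (P * diag_of m d) $$ (i, j)" .
  qed (use A P in auto)
  then have "Q * A * P = Q * (P * diag_of m d)"
    using A P Q by (simp add: assoc_mult_mat[of _ m m _ m _ m])
  also have "\<dots> = diag_of m d"
    using P Q PQ by (simp flip: assoc_mult_mat[of _ m m _ m _ m])
  finally show ?thesis using that P Q PQ by blast
qed

lemma commutator_conj:
  fixes P Q X Y :: "'a::comm_ring_1 mat"
  assumes P: "P \<in> carrier_mat m m" and Q: "Q \<in> carrier_mat m m" and PQ: "P * Q = 1\<^sub>m m"
    and X: "X \<in> carrier_mat m m" and Y: "Y \<in> carrier_mat m m"
  shows "commutator (Q * X * P) (Q * Y * P) = Q * commutator X Y * P"
proof -
  note a = assoc_mult_mat[of _ m m _ m _ m] mult_carrier_mat[of _ m m _ m]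
  have prod: "(Q * U * P) * (Q * V * P) = Q * (U * V) * P"
    if "U \<in> carrier_mat m m" "V \<in> carrier_mat m m" for U V
  proof -
    have "(Q * U * P) * (Q * V * P) = Q * U * ((P * Q) * (V * P))"
      using that P Q by (simp add: a)
    then show ?thesis using that P Q by (simp add: PQ a)
  qed
  have "Q * (X * Y - Y * X) * P = Q * (X * Y) * P - Q * (Y * X) * P"
    using P Q X Y by (simp add: mult_minus_distrib_mat[of _ m m _ m] minus_mult_distrib_mat[of _ m m _ _ m] a)
  then show ?thesis using prod X Y by (simp add: commutator_def)
qed

lemma conj_conj:
  fixes P Q X :: "'a::comm_ring_1 mat"
  assumes "P \<in> carrier_mat m m" "Q \<in> carrier_mat m m" "P * Q = 1\<^sub>m m" "X \<in> carrier_mat m m"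
  shows "P * (Q * X * P) * Q = X"
proof -
  note a = assoc_mult_mat[of _ m m _ m _ m] mult_carrier_mat[of _ m m _ m]
  have "P * (Q * X * P) * Q = (P * Q) * (X * (P * Q))"
    using assms(1,2,4) by (simp add: a)
  then show ?thesis
    using assms(3,4) by (simp add: left_mult_one_mat[of X m m] right_mult_one_mat[of X m m])
qed

lemma smult_mult_mat_vec:
  fixes A :: "'a::comm_ring_1 mat"
  assumes "A \<in> carrier_mat m m" "v \<in> carrier_vec m"
  shows "(c \<cdot>\<^sub>m A) *\<^sub>v v = c \<cdot>\<^sub>v (A *\<^sub>v v)"
  using assms by (intro eq_vecI) (auto simp: scalar_prod_def sum_distrib_left mult.assoc)

text \<open>Invariance is tested on the \<open>t p q\<close> alone. In the application they span the
  image of \<open>sp_alg N\<close>, so this is ordinary irreducibility.\<close>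

locale irreducible_sp_rep = sp_rep +
  assumes m_pos: "m > 0"
    and irreducible: "csubspace_vec m W \<Longrightarrow>
      (\<And>p q w. p < 2 * N \<Longrightarrow> q < 2 * N \<Longrightarrow> w \<in> W \<Longrightarrow> t p q *\<^sub>v w \<in> W) \<Longrightarrow>
      W = {0\<^sub>v m} \<or> W = carrier_vec m"
begin

lemma eigenvector_exists:
  fixes A :: "complex mat"
  assumes "A \<in> carrier_mat m m"
  obtains v \<mu> where "v \<in> carrier_vec m" "v \<noteq> 0\<^sub>v m" "A *\<^sub>v v = \<mu> \<cdot>\<^sub>v v"
  using spectrum_non_empty[OF assms m_pos] assms
  by (auto simp: spectrum_def eigenvalue_def eigenvector_def)

text \<open>Schur's lemma: an eigenspace of \<open>\<Phi>\<close> is invariant and nonzero, hence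
  the whole space.\<close>

lemma commuting_is_scalar:
  assumes \<Phi>: "\<Phi> \<in> carrier_mat m m"
    and comm: "\<And>p q. p < 2 * N \<Longrightarrow> q < 2 * N \<Longrightarrow> commutator (t p q) \<Phi> = 0\<^sub>m m m"
  shows "\<exists>c. \<Phi> = c \<cdot>\<^sub>m 1\<^sub>m m"
proof -
  obtain v \<mu> where v: "v \<in> carrier_vec m" "v \<noteq> 0\<^sub>v m" "\<Phi> *\<^sub>v v = \<mu> \<cdot>\<^sub>v v"
    using eigenvector_exists[OF \<Phi>] .
  define W where "W = {v \<in> carrier_vec m. \<Phi> *\<^sub>v v = \<mu> \<cdot>\<^sub>v v}"
  have "W = {0\<^sub>v m} \<or> W = carrier_vec m"
  proof (rule irreducible)
    show "csubspace_vec m W"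
      unfolding csubspace_vec_def W_def using \<Phi>
      by (auto simp: mult_add_distrib_mat_vec[of _ m m] smult_add_distrib_vec[of _ m]
          mult_mat_vec[of _ m m] smult_smult_assoc mult.commute)
    fix p q w assume pq: "p < 2 * N" "q < 2 * N" and w: "w \<in> W"
    have "\<Phi> *\<^sub>v (t p q *\<^sub>v w) = (\<Phi> * t p q) *\<^sub>v w"
      using \<Phi> t_carrier[OF pq] w by (simp add: W_def assoc_mult_mat_vec[of _ m m _ m])
    also have "\<dots> = (t p q * \<Phi>) *\<^sub>v w"
      using comm[OF pq] \<Phi> t_carrier[OF pq] by (simp add: commutator_eq_0_iff)
    also have "\<dots> = t p q *\<^sub>v (\<mu> \<cdot>\<^sub>v w)"
      using \<Phi> t_carrier[OF pq] w by (simp add: W_def assoc_mult_mat_vec[of _ m m _ m])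
    also have "\<dots> = \<mu> \<cdot>\<^sub>v (t p q *\<^sub>v w)"
      using t_carrier[OF pq] w by (simp add: W_def mult_mat_vec[of _ m m])
    finally show "t p q *\<^sub>v w \<in> W"
      using t_carrier[OF pq] w by (auto simp: W_def)
  qed
  then have W: "W = carrier_vec m" using v by (auto simp: W_def)
  have "\<Phi> = \<mu> \<cdot>\<^sub>m 1\<^sub>m m"
  proof (rule eq_matI)
    fix i j assume "i < dim_row (\<mu> \<cdot>\<^sub>m 1\<^sub>m m)" "j < dim_col (\<mu> \<cdot>\<^sub>m 1\<^sub>m m)"
    then have ij: "i < m" "j < m" by auto
    have "unit_vec m j \<in> W" by (simp add: W)
    then have "(\<Phi> *\<^sub>v unit_vec m j) $ i = (\<mu> \<cdot>\<^sub>v unit_vec m j) $ i" by (simp add: W_def)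
    then show "\<Phi> $$ (i, j) = (\<mu> \<cdot>\<^sub>m 1\<^sub>m m) $$ (i, j)" using ij \<Phi> by auto
  qed (use \<Phi> in auto)
  then show ?thesis by blast
qed

text \<open>Every \<open>t p q\<close> maps an eigenvector of \<open>t N 0\<close> to an eigenvector
  or to 0, shifting the eigenvalue by \<open>grade p + grade q\<close>. The span of the eigenvectors
  is thus invariant, and it is nonzero over the complex numbers.\<close>

lemma grading_diagonalizable:
  obtains P Q d where "P \<in> carrier_mat m m" "Q \<in> carrier_mat m m" "P * Q = 1\<^sub>m m" "Q * P = 1\<^sub>m m"
    "Q * t N 0 * P = diag_of m d"
proof -
  let ?H = "t N 0"
  have H: "?H \<in> carrier_mat m m" using N_pos by simp
  define S where "S = {v \<in> carrier_vec m. \<exists>\<mu>. ?H *\<^sub>v v = \<mu> \<cdot>\<^sub>v v}"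
  have S_inv: "t p q *\<^sub>v v \<in> S" if pq: "p < 2 * N" "q < 2 * N" and v: "v \<in> S" for p q v
  proof -
    let ?k = "grade p + grade q"
    have T: "t p q \<in> carrier_mat m m" using pq by simp
    obtain \<mu> where vc: "v \<in> carrier_vec m" and \<mu>: "?H *\<^sub>v v = \<mu> \<cdot>\<^sub>v v" using v by (auto simp: S_def)
    have "?H * t p q - t p q * ?H = ?k \<cdot>\<^sub>m t p q"
      using bracket_grading[OF pq] by (simp add: commutator_def)
    then have "(?H * t p q - t p q * ?H) *\<^sub>v v = (?k \<cdot>\<^sub>m t p q) *\<^sub>v v" by simp
    moreover have "(?H * t p q - t p q * ?H) *\<^sub>v v = ?H *\<^sub>v (t p q *\<^sub>v v) - \<mu> \<cdot>\<^sub>v (t p q *\<^sub>v v)"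
      using H T vc \<mu> by (simp add: minus_mult_distrib_mat_vec[of _ m m] assoc_mult_mat_vec[of _ m m _ m]
          mult_mat_vec[of _ m m])
    ultimately have eq: "?H *\<^sub>v (t p q *\<^sub>v v) - \<mu> \<cdot>\<^sub>v (t p q *\<^sub>v v) = ?k \<cdot>\<^sub>v (t p q *\<^sub>v v)"
      using T vc by (simp add: smult_mult_mat_vec[of _ m])
    have "?H *\<^sub>v (t p q *\<^sub>v v) = (\<mu> + ?k) \<cdot>\<^sub>v (t p q *\<^sub>v v)"
    proof (rule eq_vecI)
      fix i assume "i < dim_vec ((\<mu> + ?k) \<cdot>\<^sub>v (t p q *\<^sub>v v))"
      then have i: "i < m" using T by simp
      have "(?H *\<^sub>v (t p q *\<^sub>v v) - \<mu> \<cdot>\<^sub>v (t p q *\<^sub>v v)) $ i = (?k \<cdot>\<^sub>v (t p q *\<^sub>v v)) $ i" by (simp only: eq)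
      then show "(?H *\<^sub>v (t p q *\<^sub>v v)) $ i = ((\<mu> + ?k) \<cdot>\<^sub>v (t p q *\<^sub>v v)) $ i"
        using i H T by (simp add: algebra_simps del: index_mult_mat_vec)
    qed (use H T in auto)
    then show ?thesis using T vc by (auto simp: S_def)
  qed
  \<comment> \<open>The span of \<open>S\<close>, taken as an intersection of subspaces so that its
    minimality yields invariance directly.\<close>
  define W0 where "W0 = \<Inter>{W. csubspace_vec m W \<and> S \<subseteq> W}"
  have full: "csubspace_vec m (carrier_vec m)" by (auto simp: csubspace_vec_def)
  have W0: "csubspace_vec m W0"
    using full unfolding W0_def csubspace_vec_def by (auto simp: S_def)
  have t_zero: "t p q *\<^sub>v 0\<^sub>v m = 0\<^sub>v m" if "p < 2 * N" "q < 2 * N" for p q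
    using t_carrier[OF that] by (intro eq_vecI) auto
  have W0_least: "W0 \<subseteq> W" if "csubspace_vec m W" "S \<subseteq> W" for W
    using that by (auto simp: W0_def)
  have SW0: "S \<subseteq> W0" by (auto simp: W0_def)
  have "W0 = {0\<^sub>v m} \<or> W0 = carrier_vec m"
  proof (rule irreducible[OF W0])
    fix p q w assume pq: "p < 2 * N" "q < 2 * N" and w: "w \<in> W0"
    \<comment> \<open>The preimage of \<open>W0\<close> under \<open>t p q\<close> is a subspace
      containing \<open>S\<close>.\<close>
    have "W0 \<subseteq> {w \<in> carrier_vec m. t p q *\<^sub>v w \<in> W0}"
    proof (rule W0_least)
      show "csubspace_vec m {w \<in> carrier_vec m. t p q *\<^sub>v w \<in> W0}"
        using W0 t_carrier[OF pq] unfolding csubspace_vec_def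
        by (auto simp: t_zero[OF pq] mult_add_distrib_mat_vec[of _ m m] mult_mat_vec[of _ m m])
      show "S \<subseteq> {w \<in> carrier_vec m. t p q *\<^sub>v w \<in> W0}"
        using S_inv[OF pq] SW0 by (auto simp: S_def)
    qed
    then show "t p q *\<^sub>v w \<in> W0" using w by blast
  qed
  moreover obtain v \<mu> where "v \<in> carrier_vec m" "v \<noteq> 0\<^sub>v m" "?H *\<^sub>v v = \<mu> \<cdot>\<^sub>v v"
    using eigenvector_exists[OF H] .
  then have "v \<in> W0" "v \<noteq> 0\<^sub>v m" using SW0 by (auto simp: S_def)
  ultimately have "W0 = carrier_vec m" by blast
  then have "W = carrier_vec m" if "csubspace_vec m W" "S \<subseteq> W" for W
    using W0_least[OF that] that(1) by (auto simp: csubspace_vec_def)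
  then show ?thesis
    using diagonalizable_if_eigenvectors_span[OF H] that unfolding S_def by blast
qed

text \<open>In the application the \<open>t N q\<close> with \<open>q\<close> nonzero span the image
  of the Heisenberg algebra. Conjugating by an eigenbasis of \<open>t N 0\<close> reduces the claim
  to \<open>commuting_idempotent_diagonal\<close>.\<close>

theorem commuting_idempotent:
  assumes E: "E \<in> carrier_mat m m" and idem: "E * E = E"
    and comm: "\<And>q. 0 < q \<Longrightarrow> q < 2 * N \<Longrightarrow> commutator (t N q) E = 0\<^sub>m m m"
  shows "E = 0\<^sub>m m m \<or> E = 1\<^sub>m m"
proof -
  obtain P Q d where P: "P \<in> carrier_mat m m" and Q: "Q \<in> carrier_mat m m"
    and PQ: "P * Q = 1\<^sub>m m" and QP: "Q * P = 1\<^sub>m m" and diag: "Q * t N 0 * P = diag_of m d"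
    using grading_diagonalizable .
  note a = assoc_mult_mat[of _ m m _ m _ m] mult_carrier_mat[of _ m m _ m]
  note dist = mult_add_distrib_mat[of _ m m _ m] add_mult_distrib_mat[of _ m m _ _ m]
    mult_smult_distrib[of _ m m _ m] mult_smult_assoc_mat[of _ m m _ m] add_carrier_mat
  interpret conj: sp_rep_schur N m "\<lambda>p q. Q * t p q * P"
  proof
    show "N > 0" by (rule N_pos)
    show "Q * t p q * P = Q * t q p * P" for p q by (simp only: t_sym)
    show "Q * t p q * P \<in> carrier_mat m m" if "p < 2 * N" "q < 2 * N" for p q
      using P Q that by (simp add: a)
    show "commutator (Q * t p q * P) (Q * t r s * P) =
        sympl N q r \<cdot>\<^sub>m (Q * t p s * P) + sympl N q s \<cdot>\<^sub>m (Q * t p r * P) +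
        sympl N p r \<cdot>\<^sub>m (Q * t q s * P) + sympl N p s \<cdot>\<^sub>m (Q * t q r * P)"
      if "p < 2 * N" "q < 2 * N" "r < 2 * N" "s < 2 * N" for p q r s
      unfolding commutator_conj[OF P Q PQ t_carrier[OF that(1,2)] t_carrier[OF that(3,4)]] bracket[OF that]
      using that P Q by (simp add: dist a)
    fix \<Phi> :: "complex mat"
    assume \<Phi>: "\<Phi> \<in> carrier_mat m m"
      and c: "\<And>p q. p < 2 * N \<Longrightarrow> q < 2 * N \<Longrightarrow> commutator (Q * t p q * P) \<Phi> = 0\<^sub>m m m"
    \<comment> \<open>Commutation is carried back to the original family, where irreducibility makes
      the matrix scalar; conjugation fixes scalars.\<close>
    have "commutator (t p q) (P * \<Phi> * Q) = 0\<^sub>m m m" if pq: "p < 2 * N" "q < 2 * N" for p q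
    proof -
      have "commutator (t p q) (P * \<Phi> * Q) = commutator (P * (Q * t p q * P) * Q) (P * \<Phi> * Q)"
        using conj_conj[OF P Q PQ] pq by simp
      also have "\<dots> = P * commutator (Q * t p q * P) \<Phi> * Q"
        using pq \<Phi> P Q by (intro commutator_conj[OF Q P QP]) (simp_all add: a)
      finally show ?thesis using c[OF pq] P Q by simp
    qed
    then obtain k where k: "P * \<Phi> * Q = k \<cdot>\<^sub>m 1\<^sub>m m"
      using commuting_is_scalar[of "P * \<Phi> * Q"] P Q \<Phi> by (auto simp: a)
    have "\<Phi> = Q * (P * \<Phi> * Q) * P" using conj_conj[OF Q P QP \<Phi>] by simp
    also have "\<dots> = k \<cdot>\<^sub>m 1\<^sub>m m" using P Q QP by (simp add: k dist)
    finally show "\<exists>c. \<Phi> = c \<cdot>\<^sub>m 1\<^sub>m m" by blast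
  qed
  let ?E = "Q * E * P"
  have "?E = 0\<^sub>m m m \<or> ?E = 1\<^sub>m m"
  proof (rule conj.commuting_idempotent_diagonal[OF diag])
    show "?E \<in> carrier_mat m m" using P Q E by (simp add: a)
    have "?E * ?E = Q * E * ((P * Q) * (E * P))" using P Q E by (simp add: a)
    also have "\<dots> = Q * (E * E) * P" using P Q E by (simp add: PQ a)
    finally show "?E * ?E = ?E" by (simp add: idem)
    show "commutator (Q * t N q * P) ?E = 0\<^sub>m m m" if "0 < q" "q < 2 * N" for q
      using comm[OF that] P Q E N_pos that by (subst commutator_conj[OF P Q PQ]) simp_all
  qed
  moreover have "E = P * ?E * Q" using conj_conj[OF P Q PQ E] by simp
  ultimately show ?thesis using P Q PQ by auto
qed

end

subsection \<open>Decompositions and idempotents\<close>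

lemma csubspace_mat_mult_vec:
  assumes U: "csubspace_vec m U" and M: "M \<in> carrier_mat m m" and v: "v \<in> carrier_vec m"
    and cols: "\<And>i. i < m \<Longrightarrow> col M i \<in> U"
  shows "M *\<^sub>v v \<in> U"
proof -
  \<comment> \<open>The combination of the first \<open>k\<close> columns;
    \<open>csubspace_vec\<close> provides only binary sums, hence the induction.\<close>
  define part where "part k = vec m (\<lambda>a. \<Sum>i<k. M $$ (a, i) * v $ i)" for k
  have "k \<le> m \<Longrightarrow> part k \<in> U" for k
  proof (induction k)
    case 0
    have "part 0 = 0\<^sub>v m" by (auto simp: part_def)
    then show ?case using U by (simp add: csubspace_vec_def)
  next
    case (Suc k)
    have "part (Suc k) = part k + v $ k \<cdot>\<^sub>v col M k"
      using Suc.prems M by (intro eq_vecI) (auto simp: part_def)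
    then show ?case using Suc cols[of k] U by (simp add: csubspace_vec_def)
  qed
  moreover have "M *\<^sub>v v = part m"
    using M v by (intro eq_vecI) (auto simp: part_def scalar_prod_def atLeast0LessThan)
  ultimately show ?thesis by simp
qed

lemma eq_mat_if_mult_vec_eq:
  fixes A B :: "'a::comm_ring_1 mat"
  assumes A: "A \<in> carrier_mat m m" and B: "B \<in> carrier_mat m m"
    and eq: "\<And>v. v \<in> carrier_vec m \<Longrightarrow> A *\<^sub>v v = B *\<^sub>v v"
  shows "A = B"
proof (rule eq_matI)
  fix i j assume "i < dim_row B" "j < dim_col B"
  then have ij: "i < m" "j < m" using B by auto
  have "(A *\<^sub>v unit_vec m j) $ i = (B *\<^sub>v unit_vec m j) $ i" by (simp add: eq)
  then show "A $$ (i, j) = B $$ (i, j)" using ij A B by simp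
qed (use A B in auto)

text \<open>A decomposition into invariant \<open>U\<close> and \<open>W\<close> yields the
  projection onto \<open>U\<close> along \<open>W\<close>, a commuting idempotent. If it is 0 or 1,
  then \<open>U\<close> or \<open>W\<close> is zero.\<close>

lemma indecomposable_if_commuting_idempotents_trivial:
  assumes m: "m > 0"
    and carr: "\<And>X. X \<in> L \<Longrightarrow> \<rho> X \<in> carrier_mat m m"
    and triv: "\<And>E. E \<in> carrier_mat m m \<Longrightarrow> E * E = E \<Longrightarrow> (\<And>X. X \<in> L \<Longrightarrow> \<rho> X * E = E * \<rho> X) \<Longrightarrow>
      E = 0\<^sub>m m m \<or> E = 1\<^sub>m m"
  shows "indecomposable_rep L m \<rho>"
  unfolding indecomposable_rep_def
proof (intro conjI m notI, elim exE conjE)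
  fix U W
  assume U: "csubspace_vec m U" and W: "csubspace_vec m W"
    and invU: "invariant_sub L \<rho> U" and invW: "invariant_sub L \<rho> W"
    and "U \<noteq> {0\<^sub>v m}" "W \<noteq> {0\<^sub>v m}" and int: "U \<inter> W = {0\<^sub>v m}"
    and sum: "\<forall>v\<in>carrier_vec m. \<exists>u\<in>U. \<exists>w\<in>W. v = u + w"
  have Uc: "U \<subseteq> carrier_vec m" and Wc: "W \<subseteq> carrier_vec m" and zero: "0\<^sub>v m \<in> U" "0\<^sub>v m \<in> W"
    using U W by (auto simp: csubspace_vec_def)
  have minus: "a - b \<in> V" if V: "csubspace_vec m V" and ab: "a \<in> V" "b \<in> V" for a b V
  proof -
    have "a \<in> carrier_vec m" "b \<in> carrier_vec m" using V ab by (auto simp: csubspace_vec_def)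
    then have "a - b = a + (-1) \<cdot>\<^sub>v b" by (intro eq_vecI) auto
    then show ?thesis using V ab by (simp add: csubspace_vec_def)
  qed
  have unique: "u = u'" if u: "u \<in> U" "u' \<in> U" and w: "w \<in> W" "w' \<in> W" and eq: "u + w = u' + w'" for u u' w w'
  proof -
    have c: "u \<in> carrier_vec m" "u' \<in> carrier_vec m" "w \<in> carrier_vec m" "w' \<in> carrier_vec m"
      using u w Uc Wc by auto
    have "u - u' = w' - w"
    proof (rule eq_vecI)
      fix i assume "i < dim_vec (w' - w)"
      then have i: "i < m" using c by simp
      have "(u + w) $ i = (u' + w') $ i" by (simp only: eq)
      then show "(u - u') $ i = (w' - w) $ i" using i c by (simp add: algebra_simps)
    qed (use c in auto)
    then have "u - u' \<in> U \<inter> W" using minus[OF U u] minus[OF W w(2,1)] by simp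
    then have z: "u - u' = 0\<^sub>v m" using int by simp
    show ?thesis
    proof (rule eq_vecI)
      fix i assume "i < dim_vec u'"
      then have i: "i < m" using c by simp
      have "(u - u') $ i = 0" using i by (simp add: z)
      then show "u $ i = u' $ i" using i c by simp
    qed (use c in auto)
  qed
  have "\<exists>u w. u \<in> U \<and> w \<in> W \<and> unit_vec m i = u + w" for i
    using sum unit_vec_carrier[of m i] by blast
  then obtain u w where uw: "\<And>i. u i \<in> U" "\<And>i. w i \<in> W" "\<And>i. unit_vec m i = u i + w i" by metis
  \<comment> \<open>Column \<open>i\<close> of the projection is the \<open>U\<close>-component of
    the \<open>i\<close>-th unit vector.\<close>
  define E where "E = mat m m (\<lambda>(a, i). u i $ a)"
  have E: "E \<in> carrier_mat m m" by (simp add: E_def)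
  have E_U: "E *\<^sub>v v \<in> U" if "v \<in> carrier_vec m" for v
  proof (rule csubspace_mat_mult_vec[OF U E that])
    fix i assume i: "i < m"
    have "col E i = u i" using i uw(1)[of i] Uc by (intro eq_vecI) (auto simp: E_def)
    then show "col E i \<in> U" using uw(1) by simp
  qed
  have E_W: "(1\<^sub>m m - E) *\<^sub>v v \<in> W" if "v \<in> carrier_vec m" for v
  proof (rule csubspace_mat_mult_vec[OF W _ that])
    fix i assume i: "i < m"
    have c: "u i \<in> carrier_vec m" "w i \<in> carrier_vec m" using uw Uc Wc by auto
    have "col (1\<^sub>m m - E) i = w i"
    proof (rule eq_vecI)
      fix a assume "a < dim_vec (w i)"
      then have a: "a < m" using c by simp
      have "unit_vec m i $ a = (u i + w i) $ a" by (simp only: uw(3))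
      then show "col (1\<^sub>m m - E) i $ a = w i $ a"
        using a i c by (simp add: E_def unit_vec_def algebra_simps)
    qed (use c E in auto)
    then show "col (1\<^sub>m m - E) i \<in> W" using uw(2) by simp
  qed (use E in auto)
  have split: "v = E *\<^sub>v v + (1\<^sub>m m - E) *\<^sub>v v" if "v \<in> carrier_vec m" for v
    using that E by (simp add: minus_mult_distrib_mat_vec[of _ m m], intro eq_vecI) auto
  \<comment> \<open>Uniqueness of components identifies \<open>E *\<^sub>v v\<close> from any
    splitting of \<open>v\<close>; idempotence and commutation both rest on this.\<close>
  have E_eq: "E *\<^sub>v v = u'" if "u' \<in> U" "w' \<in> W" "v = u' + w'" for v u' w'
  proof (rule unique)
    have "u' \<in> carrier_vec m" "w' \<in> carrier_vec m" using that Uc Wc by blast+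
    then have v: "v \<in> carrier_vec m" using that by simp
    show "E *\<^sub>v v \<in> U" "(1\<^sub>m m - E) *\<^sub>v v \<in> W" using E_U E_W v by auto
    show "E *\<^sub>v v + (1\<^sub>m m - E) *\<^sub>v v = u' + w'" using split[OF v] that by simp
  qed (use that in auto)
  have E_on_U: "E *\<^sub>v v = v" if "v \<in> U" for v
    using E_eq[of v "0\<^sub>v m" v] that Uc zero by auto
  have E_on_W: "E *\<^sub>v v = 0\<^sub>v m" if "v \<in> W" for v
    using E_eq[of "0\<^sub>v m" v v] that Wc zero by auto
  have triv_E: "E = 0\<^sub>m m m \<or> E = 1\<^sub>m m"
  proof (rule triv[OF E])
    show "E * E = E"
    proof (rule eq_mat_if_mult_vec_eq[of _ m])
      show "E * E *\<^sub>v v = E *\<^sub>v v" if "v \<in> carrier_vec m" for v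
        using that E E_on_U[OF E_U[OF that]] by (simp add: assoc_mult_mat_vec[of _ m m _ m])
    qed (use E in auto)
    fix X assume X: "X \<in> L"
    have Xc: "\<rho> X \<in> carrier_mat m m" using carr[OF X] .
    show "\<rho> X * E = E * \<rho> X"
    proof (rule eq_mat_if_mult_vec_eq[of _ m])
      fix v :: "complex vec" assume v: "v \<in> carrier_vec m"
      \<comment> \<open>By invariance the images of the two components of \<open>v\<close> lie in
        \<open>U\<close> and \<open>W\<close>, so they are the components of
        \<open>\<rho> X *\<^sub>v v\<close>.\<close>
      have "E *\<^sub>v (\<rho> X *\<^sub>v v) = \<rho> X *\<^sub>v (E *\<^sub>v v)"
      proof (rule E_eq)
        show "\<rho> X *\<^sub>v (E *\<^sub>v v) \<in> U" "\<rho> X *\<^sub>v ((1\<^sub>m m - E) *\<^sub>v v) \<in> W"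
          using invU invW X E_U[OF v] E_W[OF v] by (auto simp: invariant_sub_def)
        have "\<rho> X *\<^sub>v v = \<rho> X *\<^sub>v (E *\<^sub>v v + (1\<^sub>m m - E) *\<^sub>v v)"
          using split[OF v] by simp
        also have "\<dots> = \<rho> X *\<^sub>v (E *\<^sub>v v) + \<rho> X *\<^sub>v ((1\<^sub>m m - E) *\<^sub>v v)"
          using Xc E_U[OF v] E_W[OF v] Uc Wc by (intro mult_add_distrib_mat_vec[of _ m m]) auto
        finally show "\<rho> X *\<^sub>v v = \<rho> X *\<^sub>v (E *\<^sub>v v) + \<rho> X *\<^sub>v ((1\<^sub>m m - E) *\<^sub>v v)" .
      qed
      then show "\<rho> X * E *\<^sub>v v = E * \<rho> X *\<^sub>v v"
        using v E Xc by (simp add: assoc_mult_mat_vec[of _ m m _ m])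
    qed (use E Xc in auto)
  qed
  have zero_mult: "0\<^sub>m m m *\<^sub>v v = 0\<^sub>v m" if "v \<in> carrier_vec m" for v :: "complex vec"
    using that by (intro eq_vecI) auto
  from triv_E show False
  proof
    assume "E = 0\<^sub>m m m"
    then have "v = 0\<^sub>v m" if "v \<in> U" for v
      using E_on_U[OF that] subsetD[OF Uc that] by (simp add: zero_mult)
    then show False using \<open>U \<noteq> {0\<^sub>v m}\<close> zero by blast
  next
    assume "E = 1\<^sub>m m"
    then have "v = 0\<^sub>v m" if "v \<in> W" for v
      using E_on_W[OF that] subsetD[OF Wc that] by simp
    then show False using \<open>W \<noteq> {0\<^sub>v m}\<close> zero by blast
  qed
qed

subsection \<open>Generators of the symplectic algebra\<close>

text \<open>\<open>e\<^sub>p, e\<^sub>q \<mapsto> J (e\<^sub>p e\<^sub>q\<^sup>T + e\<^sub>q e\<^sub>p\<^sup>T)\<close> is the isomorphism of the symmetric square with \<open>\<ss>\<pp>\<close>; indices are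
  0-based, so \<open>\<ss>\<close> is spanned by the \<open>sp_gen N N q\<close> with \<open>q \<noteq> 0\<close>, and \<open>sp_gen N N 0\<close> is \<open>H\<close>.\<close>

definition sp_gen :: "nat \<Rightarrow> nat \<Rightarrow> nat \<Rightarrow> real mat" where
  "sp_gen N p q = mat (2 * N) (2 * N)
     (\<lambda>(i, j). (if q = j then sympl N i p else 0) + (if p = j then sympl N i q else 0))"

lemma sp_gen_carrier [simp]: "sp_gen N p q \<in> carrier_mat (2 * N) (2 * N)"
  by (simp add: sp_gen_def)

lemma sp_gen_dim [simp]: "dim_row (sp_gen N p q) = 2 * N" "dim_col (sp_gen N p q) = 2 * N"
  by (simp_all add: sp_gen_def)

lemma sp_gen_index:
  "i < 2 * N \<Longrightarrow> j < 2 * N \<Longrightarrow> sp_gen N p q $$ (i, j) =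
    (if q = j then sympl N i p else 0) + (if p = j then sympl N i q else 0)"
  by (simp add: sp_gen_def)

lemma sp_gen_sym: "sp_gen N p q = sp_gen N q p"
  by (simp add: sp_gen_def add.commute)

lemma of_real_sympl: "of_real (sympl N a b) = (sympl N a b :: complex)"
  by (simp add: sympl_def)

section \<open>The form J and membership in sp\<close>

lemma sum_sympl:
  fixes g :: "nat \<Rightarrow> real"
  assumes "i < 2 * N"
  shows "(\<Sum>k<2*N. sympl N i k * g k) = (if i < N then g (i + N) else - g (i - N))"
proof (cases "i < N")
  case True
  have "(\<Sum>k<2*N. sympl N i k * g k) = (\<Sum>k<2*N. if k = i + N then g (i + N) else 0)"
    using True by (intro sum.cong) (auto simp: sympl_def)
  then show ?thesis using True by simp
next
  case False
  have "(\<Sum>k<2*N. sympl N i k * g k) = (\<Sum>k<2*N. if k = i - N then - g (i - N) else 0)"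
    using False by (intro sum.cong) (auto simp: sympl_def)
  then show ?thesis using False assms by simp
qed

text \<open>Entrywise form of J^2 = -1.\<close>

lemma sum_sympl_sympl:
  assumes "i < 2 * N" "j < 2 * N"
  shows "(\<Sum>k<2*N. sympl N i k * sympl N k j) = (if i = j then -1 else 0 :: real)"
  unfolding sum_sympl[OF assms(1)] using assms by (auto simp: sympl_def)

lemma Jmat_carrier [simp]: "Jmat N \<in> carrier_mat (2 * N) (2 * N)"
  unfolding Jmat_def mult_2 by (intro four_block_carrier_mat) auto

lemma Jmat_dim [simp]: "dim_row (Jmat N) = 2 * N" "dim_col (Jmat N) = 2 * N"
  using Jmat_carrier[of N] by (auto simp del: Jmat_carrier)

lemma Jmat_index: "i < 2 * N \<Longrightarrow> j < 2 * N \<Longrightarrow> Jmat N $$ (i, j) = sympl N i j"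
  by (auto simp: Jmat_def sympl_def)

definition J_mult :: "nat \<Rightarrow> real mat \<Rightarrow> nat \<Rightarrow> nat \<Rightarrow> real" where
  "J_mult N X i j = (\<Sum>k<2*N. sympl N i k * X $$ (k, j))"

text \<open>As J is antisymmetric, \<open>transpose_mat X * Jmat N\<close> is minus the transpose of
  \<open>Jmat N * X\<close>; so the defining equation says that J X is symmetric. The case
  \<open>N = 0\<close> is separate because \<open>sympl\<close> is not antisymmetric there.\<close>

lemma mem_sp_alg_iff:
  "X \<in> sp_alg N \<longleftrightarrow> X \<in> carrier_mat (2 * N) (2 * N) \<and>
    (\<forall>i<2*N. \<forall>j<2*N. J_mult N X i j = J_mult N X j i)"
proof (cases "X \<in> carrier_mat (2 * N) (2 * N)")
  case X: True
  show ?thesis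
  proof (cases "N > 0")
    case N: True
    have entry: "(transpose_mat X * Jmat N + Jmat N * X) $$ (i, j) = J_mult N X i j - J_mult N X j i"
      if ij: "i < 2 * N" "j < 2 * N" for i j
    proof -
      have "(transpose_mat X * Jmat N) $$ (i, j) = (\<Sum>k<2*N. X $$ (k, i) * sympl N k j)"
        using X ij by (auto simp: scalar_prod_def atLeast0LessThan Jmat_index intro!: sum.cong)
      also have "\<dots> = - J_mult N X j i"
        unfolding J_mult_def sum_negf[symmetric]
        by (intro sum.cong refl) (simp add: sympl_swap[OF N, of j])
      moreover have "(Jmat N * X) $$ (i, j) = J_mult N X i j"
        using X ij by (auto simp: J_mult_def scalar_prod_def atLeast0LessThan Jmat_index intro!: sum.cong)
      ultimately show ?thesis
        using X ij by (simp del: index_mult_mat(1))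
    qed
    have "transpose_mat X * Jmat N + Jmat N * X = 0\<^sub>m (2 * N) (2 * N) \<longleftrightarrow>
        (\<forall>i<2*N. \<forall>j<2*N. J_mult N X i j = J_mult N X j i)"
    proof
      assume *: "transpose_mat X * Jmat N + Jmat N * X = 0\<^sub>m (2 * N) (2 * N)"
      show "\<forall>i<2*N. \<forall>j<2*N. J_mult N X i j = J_mult N X j i"
      proof (intro allI impI)
        fix i j assume ij: "i < 2 * N" "j < 2 * N"
        show "J_mult N X i j = J_mult N X j i"
          using entry[OF ij] ij unfolding * by simp
      qed
    next
      assume "\<forall>i<2*N. \<forall>j<2*N. J_mult N X i j = J_mult N X j i"
      then show "transpose_mat X * Jmat N + Jmat N * X = 0\<^sub>m (2 * N) (2 * N)"
        using X entry by (intro eq_matI) (auto simp del: index_mult_mat(1) index_add_mat(1))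
    qed
    then show ?thesis using X by (simp add: sp_alg_def)
  next
    case False
    then have "transpose_mat X * Jmat N + Jmat N * X = 0\<^sub>m (2 * N) (2 * N)"
      using X by (intro eq_matI) auto
    then show ?thesis using X False by (simp add: sp_alg_def)
  qed
next
  case False
  then show ?thesis by (simp add: sp_alg_def)
qed

lemma J_mult_linear:
  assumes "X \<in> carrier_mat (2 * N) (2 * N)" "Y \<in> carrier_mat (2 * N) (2 * N)" "j < 2 * N"
  shows "J_mult N (X + Y) i j = J_mult N X i j + J_mult N Y i j"
    and "J_mult N (c \<cdot>\<^sub>m X) i j = c * J_mult N X i j"
  using assms by (simp_all add: J_mult_def distrib_left sum.distrib sum_distrib_left mult.left_commute)

lemma sp_alg_add: "X \<in> sp_alg N \<Longrightarrow> Y \<in> sp_alg N \<Longrightarrow> X + Y \<in> sp_alg N"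
  by (auto simp: mem_sp_alg_iff J_mult_linear)

lemma sp_alg_smult: "X \<in> sp_alg N \<Longrightarrow> c \<cdot>\<^sub>m X \<in> sp_alg N"
  by (auto simp: mem_sp_alg_iff J_mult_linear(2)[where Y = X])

lemma zero_in_sp_alg: "0\<^sub>m (2 * N) (2 * N) \<in> sp_alg N"
  by (auto simp: mem_sp_alg_iff J_mult_def)

lemma sp_gen_in_sp_alg:
  assumes "p < 2 * N" "q < 2 * N"
  shows "sp_gen N p q \<in> sp_alg N"
proof -
  have "J_mult N (sp_gen N p q) i j =
      (if q = j then (if i = p then -1 else 0) else 0) + (if p = j then (if i = q then -1 else 0) else 0)"
    if ij: "i < 2 * N" "j < 2 * N" for i j
  proof -
    have "J_mult N (sp_gen N p q) i j =
        (if q = j then \<Sum>k<2*N. sympl N i k * sympl N k p else 0) +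
        (if p = j then \<Sum>k<2*N. sympl N i k * sympl N k q else 0)"
      using ij by (cases "q = j"; cases "p = j") (simp_all add: J_mult_def sp_gen_index distrib_left sum.distrib
          sum_distrib_left mult.left_commute)
    then show ?thesis using ij assms by (simp add: sum_sympl_sympl)
  qed
  then show ?thesis by (auto simp: mem_sp_alg_iff)
qed

lemma sp_alg_subset_rspan:
  "sp_alg N \<subseteq> rspan (2 * N) {sp_gen N p q | p q. p < 2 * N \<and> q < 2 * N}" (is "_ \<subseteq> rspan _ ?G")
proof
  fix X assume "X \<in> sp_alg N"
  then have X: "X \<in> carrier_mat (2 * N) (2 * N)"
    and sym: "\<And>i j. i < 2 * N \<Longrightarrow> j < 2 * N \<Longrightarrow> J_mult N X i j = J_mult N X j i"
    by (auto simp: mem_sp_alg_iff)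
  \<comment> \<open>The matrix S = -J X is symmetric and X = J S. Summing S_pq (e_p e_q^T + e_q
    e_p^T) over ordered pairs gives 2 S, whence the factor 1/2.\<close>
  define c where "c = (\<lambda>(p, q). - (1/2) * J_mult N X p q)"
  define comb where "comb A = mat (2 * N) (2 * N)
    (\<lambda>(i, j). \<Sum>a\<in>A. c a * sp_gen N (fst a) (snd a) $$ (i, j))" for A
  have comb: "comb A \<in> rspan (2 * N) ?G" if "finite A" "A \<subseteq> {..<2*N} \<times> {..<2*N}" for A
    using that
  proof (induction A rule: finite_induct)
    case empty
    have "comb {} = 0\<^sub>m (2 * N) (2 * N)" by (auto simp: comb_def)
    then show ?case by (simp add: rspan.zero)
  next
    case (insert a A)
    have "comb (insert a A) = c a \<cdot>\<^sub>m sp_gen N (fst a) (snd a) + comb A"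
      using insert.hyps by (intro eq_matI) (auto simp: comb_def)
    moreover have "sp_gen N (fst a) (snd a) \<in> ?G"
      using insert.prems by (intro CollectI exI[of _ "fst a"] exI[of _ "snd a"]) auto
    ultimately show ?case using insert by (auto intro: rspan.add)
  qed
  have "X = comb ({..<2*N} \<times> {..<2*N})"
  proof (rule eq_matI)
    fix i j
    assume "i < dim_row (comb ({..<2*N} \<times> {..<2*N}))" "j < dim_col (comb ({..<2*N} \<times> {..<2*N}))"
    then have ij: "i < 2 * N" "j < 2 * N" by (auto simp: comb_def)
    have half: "(\<Sum>p<2*N. sympl N i p * J_mult N X p j) = - X $$ (i, j)"
    proof -
      have "(\<Sum>p<2*N. sympl N i p * J_mult N X p j) =
          (\<Sum>k<2*N. (\<Sum>p<2*N. sympl N i p * sympl N p k) * X $$ (k, j))"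
        unfolding J_mult_def sum_distrib_left sum_distrib_right
        by (subst sum.swap) (simp add: mult.assoc)
      also have "\<dots> = (\<Sum>k<2*N. if k = i then - X $$ (i, j) else 0)"
        using ij by (intro sum.cong) (auto simp: sum_sympl_sympl)
      finally show ?thesis using ij by simp
    qed
    have "comb ({..<2*N} \<times> {..<2*N}) $$ (i, j) =
        (\<Sum>p<2*N. \<Sum>q<2*N. c (p, q) * sp_gen N p q $$ (i, j))"
      using ij by (simp add: comb_def sum.cartesian_product case_prod_beta)
    also have "\<dots> = (\<Sum>p<2*N. \<Sum>q<2*N. (if q = j then c (p, q) * sympl N i p else 0)) +
        (\<Sum>p<2*N. \<Sum>q<2*N. (if p = j then c (p, q) * sympl N i q else 0))"
      unfolding sum.distrib[symmetric]
      using ij by (intro sum.cong refl) (auto simp: sp_gen_index algebra_simps)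
    also have "(\<Sum>p<2*N. \<Sum>q<2*N. (if p = j then c (p, q) * sympl N i q else 0)) =
        (\<Sum>q<2*N. \<Sum>p<2*N. (if p = j then c (p, q) * sympl N i q else 0))"
      by (rule sum.swap)
    also have "(\<Sum>p<2*N. \<Sum>q<2*N. (if q = j then c (p, q) * sympl N i p else 0)) +
        (\<Sum>q<2*N. \<Sum>p<2*N. (if p = j then c (p, q) * sympl N i q else 0)) =
        (\<Sum>p<2*N. c (p, j) * sympl N i p) + (\<Sum>q<2*N. c (j, q) * sympl N i q)"
      using ij by simp
    also have "\<dots> = (\<Sum>p<2*N. - (sympl N i p * J_mult N X p j))"
      unfolding sum.distrib[symmetric]
      using ij sym[of j] by (intro sum.cong) (auto simp: c_def)
    also have "\<dots> = X $$ (i, j)"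
      by (simp add: sum_negf half)
    finally show "X $$ (i, j) = comb ({..<2*N} \<times> {..<2*N}) $$ (i, j)" by simp
  qed (use X in \<open>auto simp: comb_def\<close>)
  then show "X \<in> rspan (2 * N) ?G" using comb[of "{..<2*N} \<times> {..<2*N}"] by simp
qed

text \<open>In a product the middle factor e_q^T J e_r contracts to \<open>sympl N q r\<close>. The
  two products give eight rank one terms, which antisymmetry of the form pairs up into four
  generators.\<close>

lemma sp_gen_bracket:
  assumes "N > 0" "p < 2 * N" "q < 2 * N" "r < 2 * N" "s < 2 * N"
  shows "sp_gen N p q * sp_gen N r s - sp_gen N r s * sp_gen N p q =
    sympl N q r \<cdot>\<^sub>m sp_gen N p s + sympl N q s \<cdot>\<^sub>m sp_gen N p r +
    sympl N p r \<cdot>\<^sub>m sp_gen N q s + sympl N p s \<cdot>\<^sub>m sp_gen N q r"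
proof -
  have prod: "(sp_gen N p q * sp_gen N r s) $$ (i, j) =
      (if s = j then sympl N i p * sympl N q r + sympl N i q * sympl N p r else 0) +
      (if r = j then sympl N i p * sympl N q s + sympl N i q * sympl N p s else 0)"
    if ij: "i < 2 * N" "j < 2 * N" and pq: "p < 2 * N" "q < 2 * N" for i j p q r s
  proof -
    have "(sp_gen N p q * sp_gen N r s) $$ (i, j) =
        (\<Sum>k<2*N. sp_gen N p q $$ (i, k) * sp_gen N r s $$ (k, j))"
      using ij by (auto simp: scalar_prod_def atLeast0LessThan intro!: sum.cong)
    also have "\<dots> = (\<Sum>k<2*N. (if q = k then sympl N i p * sp_gen N r s $$ (q, j) else 0) +
        (if p = k then sympl N i q * sp_gen N r s $$ (p, j) else 0))"
      using ij by (intro sum.cong) (auto simp: sp_gen_index[of i] algebra_simps)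
    also have "\<dots> = sympl N i p * sp_gen N r s $$ (q, j) + sympl N i q * sp_gen N r s $$ (p, j)"
      using pq by (simp add: sum.distrib)
    finally show ?thesis
      using ij pq by (auto simp: sp_gen_index algebra_simps)
  qed
  note sw = sympl_swap[OF assms(1)]
  show ?thesis
  proof (rule eq_matI)
    fix i j
    assume "i < dim_row (sympl N q r \<cdot>\<^sub>m sp_gen N p s + sympl N q s \<cdot>\<^sub>m sp_gen N p r +
      sympl N p r \<cdot>\<^sub>m sp_gen N q s + sympl N p s \<cdot>\<^sub>m sp_gen N q r)"
      and "j < dim_col (sympl N q r \<cdot>\<^sub>m sp_gen N p s + sympl N q s \<cdot>\<^sub>m sp_gen N p r +
      sympl N p r \<cdot>\<^sub>m sp_gen N q s + sympl N p s \<cdot>\<^sub>m sp_gen N q r)"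
    then have ij: "i < 2 * N" "j < 2 * N" by auto
    have "(sp_gen N p q * sp_gen N r s - sp_gen N r s * sp_gen N p q) $$ (i, j) =
        (sp_gen N p q * sp_gen N r s) $$ (i, j) - (sp_gen N r s * sp_gen N p q) $$ (i, j)"
      using ij by (simp del: index_mult_mat(1))
    also have "\<dots> = (sympl N q r \<cdot>\<^sub>m sp_gen N p s + sympl N q s \<cdot>\<^sub>m sp_gen N p r +
       sympl N p r \<cdot>\<^sub>m sp_gen N q s + sympl N p s \<cdot>\<^sub>m sp_gen N q r) $$ (i, j)"
      unfolding prod[OF ij assms(2,3)] prod[OF ij assms(4,5)] sw[of r p] sw[of r q] sw[of s p] sw[of s q]
      using ij by (simp add: sp_gen_index algebra_simps)
    finally show "(sp_gen N p q * sp_gen N r s - sp_gen N r s * sp_gen N p q) $$ (i, j) =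
      (sympl N q r \<cdot>\<^sub>m sp_gen N p s + sympl N q s \<cdot>\<^sub>m sp_gen N p r +
       sympl N p r \<cdot>\<^sub>m sp_gen N q s + sympl N p s \<cdot>\<^sub>m sp_gen N q r) $$ (i, j)" .
  qed auto
qed

section \<open>The Heisenberg algebra inside sp\<close>

lemma xgen_eq_sp_gen: "k \<in> {1..n} \<Longrightarrow> xgen n k = sp_gen (n + 1) (n + 1) k"
  \<comment> \<open>The 1-based position (1, k + 1) of \<open>Emat\<close> is (0, k) in 0-based
    indexing, and the second block starts at \<open>n + 1\<close>.\<close>
  by (intro eq_matI) (auto simp: sp_gen_index xgen_def Emat_def sympl_def)

lemma ygen_eq_sp_gen: "k \<in> {1..n} \<Longrightarrow> ygen n k = sp_gen (n + 1) (n + 1) (n + 1 + k)"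
  by (intro eq_matI) (auto simp: sp_gen_index ygen_def Emat_def sympl_def)

text \<open>With equal indices both summands of \<open>sp_gen\<close> contribute, which gives the
  factor 2.\<close>

lemma zgen_eq_sp_gen: "zgen n = sp_gen (n + 1) (n + 1) (n + 1)"
  by (intro eq_matI) (auto simp: sp_gen_index zgen_def Emat_def sympl_def)

lemma sp_gen_in_s_alg:
  assumes "0 < q" "q < 2 * (n + 1)"
  shows "sp_gen (n + 1) (n + 1) q \<in> s_alg n"
proof -
  let ?G = "{xgen n k | k. k \<in> {1..n}} \<union> {ygen n k | k. k \<in> {1..n}} \<union> {zgen n}"
  \<comment> \<open>The three ranges belong to the x, to z and to the y in turn.\<close>
  consider "q \<in> {1..n}" | "q = n + 1" | k where "k \<in> {1..n}" "q = n + 1 + k"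
  proof -
    have "q \<in> {1..n} \<or> q = n + 1 \<or> (q - (n + 1) \<in> {1..n} \<and> q = n + 1 + (q - (n + 1)))"
      using assms by auto
    then show ?thesis using that by blast
  qed
  then have "sp_gen (n + 1) (n + 1) q \<in> ?G"
  proof cases
    case 1
    then show ?thesis using xgen_eq_sp_gen[of q n, symmetric] by blast
  next
    case 2
    then show ?thesis using zgen_eq_sp_gen[of n, symmetric] by blast
  next
    case 3
    then show ?thesis using ygen_eq_sp_gen[of k n, symmetric] by blast
  qed
  then have "1 \<cdot>\<^sub>m sp_gen (n + 1) (n + 1) q + 0\<^sub>m (2 * (n+1)) (2 * (n+1)) \<in> s_alg n"
    unfolding s_alg_def by (intro rspan.add rspan.zero)
  moreover have "1 \<cdot>\<^sub>m sp_gen (n + 1) (n + 1) q + 0\<^sub>m (2 * (n+1)) (2 * (n+1)) = sp_gen (n + 1) (n + 1) q"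
    by (intro eq_matI) auto
  ultimately show ?thesis by simp
qed

lemma s_alg_subset_sp_alg: "s_alg n \<subseteq> sp_alg (n + 1)"
proof
  fix X assume "X \<in> s_alg n"
  then show "X \<in> sp_alg (n + 1)"
    unfolding s_alg_def
  proof (induction X rule: rspan.induct)
    case zero
    then show ?case using zero_in_sp_alg[of "n + 1"] by simp
  next
    case (add g X c)
    have gen: "sp_gen (n + 1) (n + 1) q \<in> sp_alg (n + 1)" if "q < 2 * (n + 1)" for q
      using sp_gen_in_sp_alg[of "n + 1" "n + 1" q] that by simp
    have "xgen n k \<in> sp_alg (n + 1)" "ygen n k \<in> sp_alg (n + 1)" if "k \<in> {1..n}" for k
      unfolding xgen_eq_sp_gen[OF that] ygen_eq_sp_gen[OF that] by (rule gen; use that in auto)+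
    moreover have "zgen n \<in> sp_alg (n + 1)"
      unfolding zgen_eq_sp_gen by (rule gen) simp
    ultimately have "g \<in> sp_alg (n + 1)" using add.hyps(1) by blast
    then show ?case using add.IH by (intro sp_alg_add sp_alg_smult)
  qed
qed

section \<open>Irreducible representations restricted to the Heisenberg algebra\<close>

theorem mainTheorem5:
  fixes n m :: nat and \<rho> :: "real mat \<Rightarrow> complex mat"
  assumes "n \<ge> 1"
    and "lie_rep (sp_alg (n + 1)) m \<rho>"
    and "irreducible_rep (sp_alg (n + 1)) m \<rho>"
  shows "indecomposable_rep (s_alg n) m \<rho>"
proof -
  define N where "N = n + 1"
  let ?L = "sp_alg N" and ?t = "\<lambda>p q. \<rho> (sp_gen N p q)"
  have rep: "lie_rep ?L m \<rho>" and irr: "irreducible_rep ?L m \<rho>"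
    unfolding N_def by (rule assms)+
  have N: "N > 0" by (simp add: N_def)
  have carr: "\<rho> X \<in> carrier_mat m m" if "X \<in> ?L" for X
    using rep that by (simp add: lie_rep_def)
  have rho_add: "\<rho> (X + Y) = \<rho> X + \<rho> Y" if "X \<in> ?L" "Y \<in> ?L" for X Y
    using rep that by (simp add: lie_rep_def)
  have rho_smult: "\<rho> (c \<cdot>\<^sub>m X) = complex_of_real c \<cdot>\<^sub>m \<rho> X" if "X \<in> ?L" for X c
    using rep that by (simp add: lie_rep_def)
  have rho_bracket: "\<rho> (X * Y - Y * X) = \<rho> X * \<rho> Y - \<rho> Y * \<rho> X" if "X \<in> ?L" "Y \<in> ?L" for X Y
    using rep that by (simp add: lie_rep_def)
  interpret irreducible_sp_rep N m ?t
  proof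
    show "N > 0" by (rule N)
    show "?t p q \<in> carrier_mat m m" if "p < 2 * N" "q < 2 * N" for p q
      using carr sp_gen_in_sp_alg that by blast
    show "?t p q = ?t q p" for p q by (simp only: sp_gen_sym)
    show "commutator (?t p q) (?t r s) = sympl N q r \<cdot>\<^sub>m ?t p s + sympl N q s \<cdot>\<^sub>m ?t p r +
        sympl N p r \<cdot>\<^sub>m ?t q s + sympl N p s \<cdot>\<^sub>m ?t q r"
      if pqrs: "p < 2 * N" "q < 2 * N" "r < 2 * N" "s < 2 * N" for p q r s
    proof -
      have "commutator (?t p q) (?t r s) =
          \<rho> (sp_gen N p q * sp_gen N r s - sp_gen N r s * sp_gen N p q)"
        using rho_bracket sp_gen_in_sp_alg pqrs by (simp add: commutator_def)
      then show ?thesis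
        unfolding sp_gen_bracket[OF N pqrs]
        using pqrs by (simp add: rho_add rho_smult sp_alg_add sp_alg_smult sp_gen_in_sp_alg of_real_sympl)
    qed
    show "m > 0" using irr by (simp add: irreducible_rep_def)
    fix W assume W: "csubspace_vec m W"
      and inv: "\<And>p q w. p < 2 * N \<Longrightarrow> q < 2 * N \<Longrightarrow> w \<in> W \<Longrightarrow> ?t p q *\<^sub>v w \<in> W"
    \<comment> \<open>Invariance extends from the generators to all of \<open>?L\<close>, since they
      span it and \<open>\<rho>\<close> is linear.\<close>
    have "\<rho> X *\<^sub>v w \<in> W" if X: "X \<in> ?L" and w: "w \<in> W" for X w
    proof -
      have wc: "w \<in> carrier_vec m" using W w by (auto simp: csubspace_vec_def)
      have "X \<in> rspan (2 * N) {sp_gen N p q | p q. p < 2 * N \<and> q < 2 * N}"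
        using X sp_alg_subset_rspan by blast
      \<comment> \<open>Membership in \<open>?L\<close> is carried along because linearity of
        \<open>\<rho>\<close> is given only there.\<close>
      then have "X \<in> ?L \<and> \<rho> X *\<^sub>v w \<in> W"
      proof (induction X rule: rspan.induct)
        case zero
        have z: "0\<^sub>m (2 * N) (2 * N) \<in> ?L" by (rule zero_in_sp_alg)
        \<comment> \<open>Homogeneity with the scalar 0 makes \<open>\<rho>\<close> vanish at the
          zero matrix.\<close>
        have "\<rho> (0\<^sub>m (2 * N) (2 * N)) = complex_of_real 0 \<cdot>\<^sub>m \<rho> (0\<^sub>m (2 * N) (2 * N))"
          by (subst rho_smult[OF z, symmetric]) simp
        then have "\<rho> (0\<^sub>m (2 * N) (2 * N)) *\<^sub>v w = 0 \<cdot>\<^sub>v (\<rho> (0\<^sub>m (2 * N) (2 * N)) *\<^sub>v w)"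
          using smult_mult_mat_vec[OF carr[OF z] wc, of 0] by simp
        also have "\<dots> = 0\<^sub>v m" using carr[OF z] by (intro eq_vecI) auto
        finally show ?case using z W by (simp add: csubspace_vec_def)
      next
        case (add g X c)
        then obtain p q where pq: "p < 2 * N" "q < 2 * N" "g = sp_gen N p q" by blast
        then have g: "g \<in> ?L" "\<rho> g *\<^sub>v w \<in> W" using sp_gen_in_sp_alg inv w by auto
        have cg: "c \<cdot>\<^sub>m g \<in> ?L" using g by (simp add: sp_alg_smult)
        have "\<rho> (c \<cdot>\<^sub>m g + X) *\<^sub>v w = complex_of_real c \<cdot>\<^sub>v (\<rho> g *\<^sub>v w) + \<rho> X *\<^sub>v w"
          using add.IH cg g wc carr
          by (simp add: rho_add rho_smult
              add_mult_distrib_mat_vec[of _ m m] smult_mult_mat_vec[of _ m])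
        then show ?case using add.IH g cg W by (simp add: sp_alg_add csubspace_vec_def)
      qed
      then show ?thesis ..
    qed
    then show "W = {0\<^sub>v m} \<or> W = carrier_vec m"
      using irr W by (simp add: irreducible_rep_def invariant_sub_def)
  qed
  show ?thesis
  proof (rule indecomposable_if_commuting_idempotents_trivial[OF m_pos])
    show "\<rho> X \<in> carrier_mat m m" if "X \<in> s_alg n" for X
      using carr s_alg_subset_sp_alg that by (auto simp: N_def)
    fix E assume E: "E \<in> carrier_mat m m" "E * E = E"
      and comm: "\<And>X. X \<in> s_alg n \<Longrightarrow> \<rho> X * E = E * \<rho> X"
    show "E = 0\<^sub>m m m \<or> E = 1\<^sub>m m"
    proof (rule commuting_idempotent[OF E])
      fix q assume q: "0 < q" "q < 2 * N"
      then have "\<rho> (sp_gen N N q) * E = E * \<rho> (sp_gen N N q)"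
        using comm sp_gen_in_s_alg[of q n] by (simp add: N_def)
      then show "commutator (\<rho> (sp_gen N N q)) E = 0\<^sub>m m m"
        using E(1) q t_carrier[of N q] N by (simp add: commutator_eq_0_iff)
    qed
  qed
qed

end
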